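(* Let $a_1, a_2$ be integers with $2 \leq a_1 < a_2$, let $a_n = a_{n-1} + a_{n-2}$ for all $n \geq 3$, and let $F_{(a_1,a_2)} = \{a_1, a_2, a_3, \ldots\} \subset \mathbb{N}$. Then $$\left[0, \dim_H(J_{F_{(a_1,a_2)}})\right] = DS(F_{(a_1,a_2)}).$$
   Context: $\mathbb{N}$ denotes the set of positive integers. For positive integers $b_1, b_2, \ldots$, let $[b_1,b_2,\ldots] := \cfrac{1}{b_1+\cfrac{1}{b_2+\cfrac{1}{b_3+\cdots}}}$ denote the infinite continued fraction (an irrational number in $[0,1]$). For $\Lambda \subseteq \mathbb{N}$, define $J_\Lambda := \{x = [b_1,b_2,\ldots] : b_i \in \Lambda \text{ for all } i\} \subset [0,1]$. $\dim_H$ denotes Hausdorff dimension (with $\dim_H(\varnothing)=0$). For an infinite set $\Lambda \subseteq \mathbb{N}$, the dimension spectrum of $\Lambda$ is $DS(\Lambda) := \{\dim_H(J_A) : A \subseteq \Lambda\}$, where $A$ ranges over all (finite or infinite) subsets of $\Lambda$. *)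

theory Defs
  imports "HOL-Analysis.Analysis"
begin

text \<open>The digits \<open>b\<^sub>1, b\<^sub>2, \<dots>\<close> are given by a function indexed from 0, so \<open>b\<^sub>i\<close> is
  \<open>b (i - 1)\<close> and \<open>cf_convergent n b\<close> is the finite continued fraction
  \<open>[b\<^sub>1, \<dots>, b\<^sub>n]\<close>.\<close>

primrec cf_convergent :: "nat \<Rightarrow> (nat \<Rightarrow> nat) \<Rightarrow> real" where
  "cf_convergent 0 b = 0"
| "cf_convergent (Suc n) b = 1 / (real (b 0) + cf_convergent n (\<lambda>i. b (Suc i)))"

text \<open>The limit exists whenever all digits are positive; the value is meaningless otherwise.\<close>

definition cfrac :: "(nat \<Rightarrow> nat) \<Rightarrow> real" where
  "cfrac b = lim (\<lambda>n. cf_convergent n b)"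

definition cf_set :: "nat set \<Rightarrow> real set" where
  "cf_set \<Lambda> = {cfrac b | b. \<forall>i. b i \<in> \<Lambda>}"

text \<open>\<open>(diam U)\<^sup>s\<close> with the usual conventions: the empty set contributes 0 for every \<open>s\<close>, and
  \<open>0\<^sup>0 = 1\<close> for a single point (whereas \<open>0 powr 0 = 0\<close>).\<close>

definition diam_power :: "real \<Rightarrow> 'a::metric_space set \<Rightarrow> ennreal" where
  "diam_power s U =
     (if U = {} then 0 else if s = 0 then 1 else ennreal (diameter U powr s))"

text \<open>Covers are indexed by \<open>nat\<close>; since the \<open>U i\<close> may be empty, this includes finite covers.
  Boundedness is required explicitly because \<open>diameter\<close> is unspecified on unbounded sets. If no
  admissible cover exists, the infimum is \<open>\<infinity>\<close>.\<close>

definition hausdorff_premeasure :: "real \<Rightarrow> real \<Rightarrow> 'a::metric_space set \<Rightarrow> ennreal" where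
  "hausdorff_premeasure s \<delta> X =
     (INF U \<in> {U :: nat \<Rightarrow> 'a set. X \<subseteq> (\<Union>i. U i) \<and> (\<forall>i. bounded (U i) \<and> diameter (U i) \<le> \<delta>)}.
        \<Sum>i. diam_power s (U i))"

definition hausdorff_measure :: "real \<Rightarrow> 'a::metric_space set \<Rightarrow> ennreal" where
  "hausdorff_measure s X = (SUP \<delta> \<in> {0<..}. hausdorff_premeasure s \<delta> X)"

definition hausdorff_dim :: "'a::metric_space set \<Rightarrow> ennreal" where
  "hausdorff_dim X = Inf {ennreal s | s. 0 \<le> s \<and> hausdorff_measure s X = 0}"

lemma hausdorff_dim_empty: "hausdorff_dim ({} :: 'a::metric_space set) = 0"
proof -
  have "hausdorff_premeasure 0 \<delta> ({} :: 'a set) = 0" if "0 < \<delta>" for \<delta>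
  proof -
    have "hausdorff_premeasure 0 \<delta> ({} :: 'a set) \<le> (\<Sum>i::nat. diam_power 0 ({} :: 'a set))"
      unfolding hausdorff_premeasure_def using that
      by (intro INF_lower2[where i = "\<lambda>_. {}"]) auto
    then show ?thesis
      by (simp add: diam_power_def)
  qed
  then have "hausdorff_measure 0 ({} :: 'a set) = 0"
    by (simp add: hausdorff_measure_def)
  then have "hausdorff_dim ({} :: 'a set) \<le> ennreal 0"
    unfolding hausdorff_dim_def by (intro Inf_lower CollectI exI[of _ 0]) simp
  then show ?thesis
    by simp
qed

definition dim_spectrum :: "nat set \<Rightarrow> ennreal set" where
  "dim_spectrum \<Lambda> = {hausdorff_dim (cf_set A) | A. A \<subseteq> \<Lambda>}"

end

theory Submission
  imports Defs
begin

text \<open>Let \<open>Z\<^sub>n(A, s)\<close> be the sum of \<open>q(w)\<^sup>-\<^sup>2\<^sup>s\<close> over the words \<open>w\<close> of length \<open>n\<close> in the digits \<open>A\<close>, where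
  \<open>q(w)\<close> is the continuant. The dimension of \<open>J\<^sub>A\<close> is at most \<open>s\<close> if some \<open>Z\<^sub>n(A, s) < 1\<close>, and at
  least \<open>s\<close> (even along finite subsets of \<open>A\<close>) if all \<open>Z\<^sub>n(A, s) \<ge> 1\<close>.

  Given \<open>0 < t < dim J\<^sub>F\<close>, go through the digits in increasing order, keeping a digit whenever the
  dimension stays at most \<open>t\<close>. The resulting \<open>A\<close> has dimension at most \<open>t\<close>. A smaller dimension is
  possible only if there is a last rejected digit \<open>a\<^sub>m\<close>, and then it is enough to see that replacing
  \<open>a\<^sub>m\<close> by all later digits does not decrease \<open>Z\<^sub>n\<close> for \<open>s < dim J\<^sub>F\<close>. This reduces to
  \<open>a\<^sub>m\<^sup>-\<^sup>2\<^sup>s \<le> \<Sum>\<^sub>j a\<^sub>m\<^sub>+\<^sub>j\<^sup>-\<^sup>2\<^sup>s\<close>. For \<open>m \<ge> 2\<close> the recurrence gives \<open>a\<^sub>m\<^sub>+\<^sub>j \<le> a\<^sub>m a\<^sub>j\<close>, and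
  \<open>\<Sum>\<^sub>j a\<^sub>j\<^sup>-\<^sup>2\<^sup>s = Z\<^sub>1(F, s) \<ge> 1\<close> because \<open>s < dim J\<^sub>F\<close>; for \<open>m = 1\<close> a single digit has dimension 0.\<close>

subsection \<open>Lower bounds for the Hausdorff dimension\<close>

text \<open>Either some member of the cover meets two of the pieces \<open>f w ` J\<close> and hence has diameter at
  least \<open>\<epsilon>\<close>, or pulling the cover back along each \<open>f w\<close> yields covers of \<open>J\<close> with fewer members.\<close>

lemma finite_cover_lower_bound:
  fixes f :: "'w \<Rightarrow> 'a::metric_space \<Rightarrow> 'a"
  assumes W: "finite W" "2 \<le> card W" and J: "J \<noteq> {}"
    and maps: "\<And>w. w \<in> W \<Longrightarrow> f w ` J \<subseteq> J"
    and c: "\<And>w. w \<in> W \<Longrightarrow> 0 < c w"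
    and expand: "\<And>w x y. w \<in> W \<Longrightarrow> x \<in> J \<Longrightarrow> y \<in> J \<Longrightarrow> c w * dist x y \<le> dist (f w x) (f w y)"
    and sep: "\<And>w w' x y. w \<in> W \<Longrightarrow> w' \<in> W \<Longrightarrow> w \<noteq> w' \<Longrightarrow> x \<in> J \<Longrightarrow> y \<in> J \<Longrightarrow>
               \<epsilon> \<le> dist (f w x) (f w' y)"
    and \<epsilon>: "0 < \<epsilon>" and s: "0 \<le> s" and sum: "1 \<le> (\<Sum>w\<in>W. c w powr s)"
    and I: "finite I" and cov: "J \<subseteq> (\<Union>i\<in>I. U i)"
    and diam: "\<And>i x y. i \<in> I \<Longrightarrow> x \<in> U i \<Longrightarrow> y \<in> U i \<Longrightarrow> dist x y \<le> d i"
    and d: "\<And>i. i \<in> I \<Longrightarrow> 0 \<le> d i"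
  shows "\<epsilon> powr s \<le> (\<Sum>i\<in>I. d i powr s)"
  using I cov diam d
proof (induction I arbitrary: U d rule: finite_psubset_induct)
  case (psubset I)
  show ?case
  proof (cases "\<exists>i\<in>I. \<exists>w\<in>W. \<exists>w'\<in>W. w \<noteq> w' \<and> (\<exists>x\<in>J. \<exists>y\<in>J. f w x \<in> U i \<and> f w' y \<in> U i)")
    case True
    then obtain i w w' x y where *: "i \<in> I" "w \<in> W" "w' \<in> W" "w \<noteq> w'" "x \<in> J" "y \<in> J"
      "f w x \<in> U i" "f w' y \<in> U i" by blast
    have "\<epsilon> \<le> d i"
      using sep[OF *(2-6)] psubset.prems(2)[OF *(1,7,8)] by simp
    then have "\<epsilon> powr s \<le> d i powr s"
      using \<epsilon> s by (intro powr_mono2) auto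
    also have "\<dots> \<le> (\<Sum>i\<in>I. d i powr s)"
      using psubset.hyps * by (intro member_le_sum) auto
    finally show ?thesis .
  next
    case False
    define I' where "I' w = {i \<in> I. \<exists>x\<in>J. f w x \<in> U i}" for w
    have disj: "I' w \<inter> I' w' = {}" if "w \<in> W" "w' \<in> W" "w \<noteq> w'" for w w'
      using False that unfolding I'_def by blast
    have ne: "I' w \<noteq> {}" if "w \<in> W" for w
    proof -
      obtain x where x: "x \<in> J" using J by blast
      then have "f w x \<in> J" using maps[OF that] by blast
      then obtain i where "i \<in> I" "f w x \<in> U i" using psubset.prems(1) by blast
      then show ?thesis using x unfolding I'_def by blast
    qed
    have sub: "I' w \<subseteq> I" for w unfolding I'_def by blast
    \<comment> \<open>Any other piece also needs members of the cover, and these lie outside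
      \<open>I' w\<close>. This is where \<open>2 \<le> card W\<close> enters.\<close>
    have psub: "I' w \<subset> I" if "w \<in> W" for w
    proof -
      have "\<not> W \<subseteq> {w}"
        using W card_mono[of "{w}" W] by auto
      then obtain w' where w': "w' \<in> W" "w' \<noteq> w" by blast
      then show ?thesis using sub[of w] sub[of w'] ne[OF w'(1)] disj[OF w'(1) that w'(2)] by blast
    qed
    have piece: "c w powr s * \<epsilon> powr s \<le> (\<Sum>i\<in>I' w. d i powr s)" if w: "w \<in> W" for w
    proof -
      \<comment> \<open>As \<open>f w\<close> shrinks distances by no more than the factor
        \<open>c w\<close>, the pulled back members have diameter bounds
        \<open>d i / c w\<close>.\<close>
      have "\<epsilon> powr s \<le> (\<Sum>i\<in>I' w. (d i / c w) powr s)"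
      proof (rule psubset.IH[OF psub[OF w], where U = "\<lambda>i. {x \<in> J. f w x \<in> U i}"])
        show "J \<subseteq> (\<Union>i\<in>I' w. {x \<in> J. f w x \<in> U i})"
        proof
          fix x assume x: "x \<in> J"
          then have "f w x \<in> J" using maps[OF w] by blast
          then show "x \<in> (\<Union>i\<in>I' w. {x \<in> J. f w x \<in> U i})"
            using psubset.prems(1) x unfolding I'_def by blast
        qed
      next
        fix i x y assume i: "i \<in> I' w" and "x \<in> {x \<in> J. f w x \<in> U i}" "y \<in> {x \<in> J. f w x \<in> U i}"
        then have "c w * dist x y \<le> d i"
          using expand[OF w, of x y] psubset.prems(2)[of i "f w x" "f w y"] sub[of w] by force
        then show "dist x y \<le> d i / c w"
          using c[OF w] by (simp add: field_simps)
      next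
        fix i assume "i \<in> I' w"
        then show "0 \<le> d i / c w" using psubset.prems(3) sub[of w] c[OF w] by auto
      qed
      also have "\<dots> = (\<Sum>i\<in>I' w. d i powr s / c w powr s)"
        by (simp only: powr_divide)
      also have "\<dots> = (\<Sum>i\<in>I' w. d i powr s) / c w powr s"
        by (simp add: sum_divide_distrib)
      finally show ?thesis using c[OF w] by (simp add: field_simps)
    qed
    \<comment> \<open>The bounds for the pieces add up without double counting because the
      \<open>I' w\<close> are disjoint.\<close>
    have "\<epsilon> powr s \<le> (\<Sum>w\<in>W. c w powr s) * \<epsilon> powr s"
      using sum mult_right_mono[of 1 "\<Sum>w\<in>W. c w powr s" "\<epsilon> powr s"] by simp
    also have "\<dots> \<le> (\<Sum>w\<in>W. \<Sum>i\<in>I' w. d i powr s)"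
      unfolding sum_distrib_right by (intro sum_mono piece)
    also have "\<dots> = (\<Sum>i\<in>(\<Union>w\<in>W. I' w). d i powr s)"
      using W disj finite_subset[OF sub psubset.hyps(1)]
      by (intro sum.UNION_disjoint[symmetric]) auto
    also have "\<dots> \<le> (\<Sum>i\<in>I. d i powr s)"
      using psubset.hyps sub by (intro sum_mono2) auto
    finally show ?thesis .
  qed
qed

text \<open>Compactness brings a countable cover down to the finite case: each \<open>U i\<close> is
  enlarged to an open neighbourhood, at a cost of at most \<open>e / 2 ^ Suc i\<close> in the
  sum.\<close>

lemma hausdorff_premeasure_lower_bound:
  fixes f :: "'w \<Rightarrow> 'a::metric_space \<Rightarrow> 'a"
  assumes W: "finite W" "2 \<le> card W" and J: "compact J" "J \<noteq> {}"
    and maps: "\<And>w. w \<in> W \<Longrightarrow> f w ` J \<subseteq> J"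
    and c: "\<And>w. w \<in> W \<Longrightarrow> 0 < c w"
    and expand: "\<And>w x y. w \<in> W \<Longrightarrow> x \<in> J \<Longrightarrow> y \<in> J \<Longrightarrow> c w * dist x y \<le> dist (f w x) (f w y)"
    and sep: "\<And>w w' x y. w \<in> W \<Longrightarrow> w' \<in> W \<Longrightarrow> w \<noteq> w' \<Longrightarrow> x \<in> J \<Longrightarrow> y \<in> J \<Longrightarrow>
               \<epsilon> \<le> dist (f w x) (f w' y)"
    and \<epsilon>: "0 < \<epsilon>" and s: "0 < s" and sum: "1 \<le> (\<Sum>w\<in>W. c w powr s)"
  shows "ennreal (\<epsilon> powr s) \<le> hausdorff_premeasure s \<delta> J"
  unfolding hausdorff_premeasure_def
proof (rule INF_greatest, clarify)
  fix U :: "nat \<Rightarrow> 'a set"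
  assume cov: "J \<subseteq> (\<Union>i. U i)" and bd: "\<forall>i. bounded (U i) \<and> diameter (U i) \<le> \<delta>"
  show "ennreal (\<epsilon> powr s) \<le> (\<Sum>i. diam_power s (U i))"
  proof (rule ennreal_le_epsilon)
    fix e :: real assume e: "0 < e"
    have diam0: "0 \<le> diameter (U i)" for i
      using bd by (simp add: diameter_ge_0)
    \<comment> \<open>Since \<open>s\<close> is positive, the power is continuous from the right
      even where the diameter is 0.\<close>
    have "\<exists>r>0. (diameter (U i) + 2 * r) powr s \<le> diameter (U i) powr s + e * (1/2) ^ Suc i" for i
    proof -
      have "((\<lambda>r. (diameter (U i) + 2 * r) powr s) \<longlongrightarrow> (diameter (U i) + 2 * 0) powr s) (at_right 0)"
        using s diam0 by (intro tendsto_powr' tendsto_intros)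
          (auto intro!: eventually_at_rightI[of 0 1] add_nonneg_nonneg)
      then have "eventually (\<lambda>r. (diameter (U i) + 2 * r) powr s < diameter (U i) powr s + e * (1/2) ^ Suc i) (at_right 0)"
        using e by (intro order_tendstoD(2)) auto
      then obtain b where "0 < b" and
        b: "\<And>r. 0 < r \<Longrightarrow> r < b \<Longrightarrow> (diameter (U i) + 2 * r) powr s < diameter (U i) powr s + e * (1/2) ^ Suc i"
        unfolding eventually_at_right_field by auto
      then have "0 < b / 2" "b / 2 < b" by auto
      from b[OF this] this(1) show ?thesis by (meson less_imp_le)
    qed
    then have "\<forall>i. \<exists>r. 0 < r \<and> (diameter (U i) + 2 * r) powr s \<le> diameter (U i) powr s + e * (1/2) ^ Suc i"
      by simp
    from choice[OF this] obtain r where r0: "\<And>i. 0 < r i" and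
      r: "\<And>i. (diameter (U i) + 2 * r i) powr s \<le> diameter (U i) powr s + e * (1/2) ^ Suc i"
      by blast
    define V where "V i = (\<Union>x\<in>U i. ball x (r i))" for i
    \<comment> \<open>Empty members stay empty when enlarged and must cost 0, as they do in
      \<open>diam_power\<close>.\<close>
    define d where "d i = (if U i = {} then 0 else diameter (U i) + 2 * r i)" for i
    have "open (V i)" for i unfolding V_def by (intro open_UN ballI open_ball)
    moreover have "J \<subseteq> (\<Union>i\<in>UNIV. V i)"
    proof
      fix x assume "x \<in> J"
      then obtain i where "x \<in> U i" using cov by blast
      then have "x \<in> V i" unfolding V_def using r0[of i] by (intro UN_I[of x]) auto
      then show "x \<in> (\<Union>i\<in>UNIV. V i)" by (intro UN_I) auto
    qed
    ultimately obtain I where I: "finite I" "J \<subseteq> (\<Union>i\<in>I. V i)"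
      by (metis compactE_image[OF J(1)])
    have dV: "dist x y \<le> d i" if xy: "x \<in> V i" "y \<in> V i" for i x y
    proof -
      obtain x' y' where *: "x' \<in> U i" "y' \<in> U i" "dist x' x < r i" "dist y' y < r i"
        using xy unfolding V_def by auto
      have "dist x' y' \<le> diameter (U i)" using bd * by (intro diameter_bounded_bound) auto
      moreover have "dist x y \<le> dist x' x + dist x' y' + dist y' y"
        by (metis add.commute add_right_mono dist_commute dist_triangle dist_triangle_le)
      ultimately show ?thesis using * unfolding d_def by auto
    qed
    have "\<epsilon> powr s \<le> (\<Sum>i\<in>I. d i powr s)"
    proof (rule finite_cover_lower_bound[where W = W and f = f and c = c and J = J and U = V])
      show "0 \<le> d i" for i
        unfolding d_def using diam0[of i] r0[of i] by simp
      show "dist x y \<le> d i" if "x \<in> V i" "y \<in> V i" for i x y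
        using that by (rule dV)
    qed (fact W J maps c expand sep \<epsilon> less_imp_le[OF s] sum I)+
    then have "ennreal (\<epsilon> powr s) \<le> ennreal (\<Sum>i\<in>I. d i powr s)"
      by (rule ennreal_leI)
    also have "\<dots> = (\<Sum>i\<in>I. ennreal (d i powr s))"
      by (simp add: sum_ennreal)
    also have "\<dots> \<le> (\<Sum>i\<in>I. diam_power s (U i) + ennreal (e * (1/2) ^ Suc i))"
    proof (rule sum_mono)
      fix i
      show "ennreal (d i powr s) \<le> diam_power s (U i) + ennreal (e * (1/2) ^ Suc i)"
        using r[of i] s e unfolding d_def diam_power_def
        by (auto simp flip: ennreal_plus intro!: ennreal_leI)
    qed
    also have "\<dots> \<le> (\<Sum>i. diam_power s (U i) + ennreal (e * (1/2) ^ Suc i))"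
      using I by (intro sum_le_suminf) auto
    also have "\<dots> = (\<Sum>i. diam_power s (U i)) + (\<Sum>i. ennreal (e * (1/2) ^ Suc i))"
      by (intro suminf_add[symmetric]) auto
    also have "(\<Sum>i. ennreal (e * (1/2) ^ Suc i)) = ennreal e"
      using sums_mult[OF power_half_series, of e] e by (intro suminf_ennreal_eq) auto
    finally show "ennreal (\<epsilon> powr s) \<le> (\<Sum>i. diam_power s (U i)) + ennreal e" .
  qed
qed

text \<open>Supplies the exponent 0, excluded in the previous bound: some member of a cover is
  nonempty and contributes 1.\<close>

lemma hausdorff_premeasure_0:
  assumes "J \<noteq> {}"
  shows "1 \<le> hausdorff_premeasure 0 \<delta> J"
  unfolding hausdorff_premeasure_def
proof (rule INF_greatest, clarify)
  fix U :: "nat \<Rightarrow> 'a set"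
  assume "J \<subseteq> (\<Union>i. U i)"
  then obtain i where "U i \<noteq> {}" using assms by blast
  then have "1 = (\<Sum>j\<in>{i}. diam_power 0 (U j))" by (simp add: diam_power_def)
  also have "\<dots> \<le> (\<Sum>j. diam_power 0 (U j))" by (intro sum_le_suminf) auto
  finally show "1 \<le> (\<Sum>j. diam_power 0 (U j))" .
qed

text \<open>Positivity at the single scale 1 suffices, the Hausdorff measure being a supremum over
  all scales.\<close>

lemma hausdorff_dim_ge:
  assumes "\<And>t. 0 \<le> t \<Longrightarrow> t < s \<Longrightarrow> 0 < hausdorff_premeasure t 1 J"
  shows "ennreal s \<le> hausdorff_dim J"
  unfolding hausdorff_dim_def
proof (rule Inf_greatest, clarify)
  fix t assume t: "0 \<le> t" "hausdorff_measure t J = 0"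
  have "hausdorff_premeasure t 1 J \<le> hausdorff_measure t J"
    unfolding hausdorff_measure_def by (intro SUP_upper) auto
  then have "\<not> t < s" using assms[of t] t by auto
  then show "ennreal s \<le> ennreal t" by (intro ennreal_leI) auto
qed

text \<open>Finitely many disjoint compact images have a common positive distance, which serves as
  the separation constant. Lowering the exponent from \<open>s\<close> to \<open>t\<close> cannot
  decrease the sum, as all ratios are below 1.\<close>

lemma hausdorff_dim_ge_self_similar:
  fixes f :: "'w \<Rightarrow> 'a::heine_borel \<Rightarrow> 'a"
  assumes W: "finite W" and J: "compact J" "J \<noteq> {}"
    and maps: "\<And>w. w \<in> W \<Longrightarrow> f w ` J \<subseteq> J"
    and cont: "\<And>w. w \<in> W \<Longrightarrow> continuous_on J (f w)"
    and c: "\<And>w. w \<in> W \<Longrightarrow> 0 < c w" "\<And>w. w \<in> W \<Longrightarrow> c w < 1"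
    and expand: "\<And>w x y. w \<in> W \<Longrightarrow> x \<in> J \<Longrightarrow> y \<in> J \<Longrightarrow> c w * dist x y \<le> dist (f w x) (f w y)"
    and disj: "\<And>w w'. w \<in> W \<Longrightarrow> w' \<in> W \<Longrightarrow> w \<noteq> w' \<Longrightarrow> f w ` J \<inter> f w' ` J = {}"
    and s: "0 < s" and sum: "1 \<le> (\<Sum>w\<in>W. c w powr s)"
  shows "ennreal s \<le> hausdorff_dim J"
proof (rule hausdorff_dim_ge)
  fix t assume t: "0 \<le> t" "t < s"
  have "c w powr s < 1" if "w \<in> W" for w
    using c[OF that] s powr_less_mono2[of s "c w" 1] by auto
  \<comment> \<open>Every summand is below 1, so a sum of at least 1 needs two of them.\<close>
  then have W2: "2 \<le> card W"
  proof -
    have "W \<noteq> {}" using sum by auto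
    moreover have "W \<noteq> {w}" for w using sum \<open>\<And>w. w \<in> W \<Longrightarrow> c w powr s < 1\<close>[of w] by auto
    ultimately have "card W \<noteq> 0" "card W \<noteq> 1" using W by (auto simp: card_1_singleton_iff)
    then show ?thesis by linarith
  qed
  have sep_ex: "\<exists>e>0. \<forall>x\<in>J. \<forall>y\<in>J. e \<le> dist (f w x) (f w' y)" if "w \<in> W" "w' \<in> W" "w \<noteq> w'" for w w'
    using separate_compact_closed[OF compact_continuous_image[OF cont[OF that(1)] J(1)]
        compact_imp_closed[OF compact_continuous_image[OF cont[OF that(2)] J(1)]] disj[OF that]]
    by (simp only: ball_simps)
  define e where
    "e w w' = (SOME e. 0 < e \<and> (\<forall>x\<in>J. \<forall>y\<in>J. e \<le> dist (f w x) (f w' y)))" for w w'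
  have e: "0 < e w w' \<and> (\<forall>x\<in>J. \<forall>y\<in>J. e w w' \<le> dist (f w x) (f w' y))"
    if "w \<in> W" "w' \<in> W" "w \<noteq> w'" for w w'
    unfolding e_def by (rule someI_ex[OF sep_ex[OF that]])
  \<comment> \<open>The element 1 makes \<open>E\<close> nonempty without further argument.\<close>
  define E where "E = insert 1 ((\<lambda>(w, w'). e w w') ` {(w, w') \<in> W \<times> W. w \<noteq> w'})"
  have "finite {(w, w') \<in> W \<times> W. w \<noteq> w'}"
    by (rule finite_subset[of _ "W \<times> W"]) (use W in auto)
  then have fin: "finite E" unfolding E_def by simp
  have E0: "0 < Min E" using fin e by (subst Min_gr_iff) (auto simp: E_def)
  have sep: "Min E \<le> dist (f w x) (f w' y)"
    if "w \<in> W" "w' \<in> W" "w \<noteq> w'" "x \<in> J" "y \<in> J" for w w' x y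
  proof -
    have "Min E \<le> e w w'" using fin that by (intro Min_le) (auto simp: E_def)
    then show ?thesis using e[OF that(1-3)] that by force
  qed
  show "0 < hausdorff_premeasure t 1 J"
  proof (cases "t = 0")
    case True
    then show ?thesis using hausdorff_premeasure_0[OF J(2), of 1]
      by (auto intro: less_le_trans[OF zero_less_one])
  next
    case False
    have "(\<Sum>w\<in>W. c w powr s) \<le> (\<Sum>w\<in>W. c w powr t)"
      using t c by (intro sum_mono powr_mono') (auto intro: less_imp_le)
    then have "ennreal (Min E powr t) \<le> hausdorff_premeasure t 1 J"
      using t False sum
      by (intro hausdorff_premeasure_lower_bound[where W = W and f = f and c = c and J = J]
            W W2 J maps c(1) expand sep E0) auto
    moreover have "0 < ennreal (Min E powr t)" using E0 by simp
    ultimately show ?thesis by (rule less_le_trans[rotated])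
  qed
qed

subsection \<open>Continued fractions and continuants\<close>

text \<open>Digits from 2 on make one step a contraction with factor 1/4, so convergence is uniform
  over all digit sequences.\<close>

lemma cf_step_contraction:
  fixes x y :: real
  assumes "2 \<le> a" "0 \<le> x" "0 \<le> y"
  shows "\<bar>1 / (a + x) - 1 / (a + y)\<bar> \<le> \<bar>x - y\<bar> / 4"
proof -
  have "1 / (a + x) - 1 / (a + y) = (y - x) / ((a + x) * (a + y))"
    using assms by (simp add: field_simps)
  moreover have "4 \<le> (a + x) * (a + y)"
    using mult_mono[of 2 "a + x" 2 "a + y"] assms by simp
  ultimately show ?thesis
    using assms frac_le[of "\<bar>x - y\<bar>" "\<bar>x - y\<bar>" 4 "(a + x) * (a + y)"]
    by (simp add: abs_mult abs_minus_commute)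
qed

lemma cf_convergent_bounds:
  assumes "\<forall>i. 2 \<le> b i"
  shows "0 \<le> cf_convergent n b" "cf_convergent n b \<le> 1 / 2"
proof -
  have "0 \<le> cf_convergent n b \<and> cf_convergent n b \<le> 1 / 2"
    using assms
  proof (induction n arbitrary: b)
    case (Suc n)
    have "0 \<le> cf_convergent n (\<lambda>i. b (Suc i))"
      using Suc.IH[of "\<lambda>i. b (Suc i)"] Suc.prems by simp
    moreover have "2 \<le> real (b 0)" using Suc.prems[rule_format, of 0] by linarith
    ultimately show ?case by (simp add: field_simps)
  qed simp
  then show "0 \<le> cf_convergent n b" "cf_convergent n b \<le> 1 / 2" by auto
qed

lemma cf_convergent_diff:
  assumes "\<forall>i. 2 \<le> b i"
  shows "\<bar>cf_convergent (n + k) b - cf_convergent n b\<bar> \<le> (1 / 4) ^ n"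
  using assms
proof (induction n arbitrary: b)
  case 0
  then show ?case using cf_convergent_bounds[of b k] by simp
next
  case (Suc n)
  have "\<bar>cf_convergent (Suc n + k) b - cf_convergent (Suc n) b\<bar>
      \<le> \<bar>cf_convergent (n + k) (\<lambda>i. b (Suc i)) - cf_convergent n (\<lambda>i. b (Suc i))\<bar> / 4"
    using Suc.prems[rule_format, of 0] Suc.prems unfolding add_Suc cf_convergent.simps
    by (intro cf_step_contraction cf_convergent_bounds(1)) (simp_all add: Suc.prems)
  also have "\<dots> \<le> (1 / 4) ^ Suc n" using Suc.IH[of "\<lambda>i. b (Suc i)"] Suc.prems by simp
  finally show ?case .
qed

lemma cf_convergent_tendsto:
  assumes "\<forall>i. 2 \<le> b i"
  shows "(\<lambda>n. cf_convergent n b) \<longlonglongrightarrow> cfrac b"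
proof -
  have "Cauchy (\<lambda>n. cf_convergent n b)"
  proof (rule metric_CauchyI)
    fix e :: real assume "0 < e"
    then obtain N where N: "(1 / 4 :: real) ^ N < e / 2"
      using real_arch_pow_inv[of "e / 2" "1 / 4"] by auto
    have *: "\<bar>cf_convergent m b - cf_convergent N b\<bar> < e / 2" if "N \<le> m" for m
      using cf_convergent_diff[OF assms, of N "m - N"] that N by simp
    show "\<exists>M. \<forall>m\<ge>M. \<forall>n\<ge>M. dist (cf_convergent m b) (cf_convergent n b) < e"
      using * by (intro exI[of _ N] allI impI) (smt (verit) dist_real_def field_sum_of_halves)
  qed
  then show ?thesis
    unfolding cfrac_def by (simp add: Cauchy_convergent convergent_LIMSEQ_iff[symmetric])
qed

lemma cfrac_bounds:
  assumes "\<forall>i. 2 \<le> b i"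
  shows "0 \<le> cfrac b" "cfrac b \<le> 1 / 2"
  using cf_convergent_bounds[OF assms]
  by (blast intro: LIMSEQ_le_const[OF cf_convergent_tendsto[OF assms]]
      LIMSEQ_le_const2[OF cf_convergent_tendsto[OF assms]])+

lemma cfrac_diff_convergent:
  assumes "\<forall>i. 2 \<le> b i"
  shows "\<bar>cfrac b - cf_convergent n b\<bar> \<le> (1 / 4) ^ n"
proof (rule LIMSEQ_le_const2)
  show "(\<lambda>k. \<bar>cf_convergent (k + n) b - cf_convergent n b\<bar>) \<longlonglongrightarrow> \<bar>cfrac b - cf_convergent n b\<bar>"
    by (intro tendsto_intros LIMSEQ_ignore_initial_segment cf_convergent_tendsto assms)
qed (use cf_convergent_diff[OF assms, of n] in \<open>auto simp: add.commute\<close>)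

lemma cfrac_Suc:
  assumes "\<forall>i. 2 \<le> b i"
  shows "cfrac b = 1 / (real (b 0) + cfrac (\<lambda>i. b (Suc i)))"
proof (rule LIMSEQ_unique)
  show "(\<lambda>n. cf_convergent (Suc n) b) \<longlonglongrightarrow> cfrac b"
    by (intro LIMSEQ_Suc cf_convergent_tendsto assms)
  have "real (b 0) + cfrac (\<lambda>i. b (Suc i)) \<noteq> 0"
    using assms[rule_format, of 0] cfrac_bounds(1)[of "\<lambda>i. b (Suc i)"] assms by fastforce
  then show "(\<lambda>n. cf_convergent (Suc n) b) \<longlonglongrightarrow> 1 / (real (b 0) + cfrac (\<lambda>i. b (Suc i)))"
    using assms by (auto intro!: tendsto_intros cf_convergent_tendsto)
qed

text \<open>\<open>cf_map [b\<^sub>1, \<dots>, b\<^sub>n] x\<close> is \<open>[b\<^sub>1, \<dots>, b\<^sub>n + x]\<close>.\<close>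

primrec cf_map :: "nat list \<Rightarrow> real \<Rightarrow> real" where
  "cf_map [] x = x"
| "cf_map (a # w) x = 1 / (real a + cf_map w x)"

text \<open>\<open>cf_denom [b\<^sub>1, \<dots>, b\<^sub>n] 1 0 x\<close> is \<open>q\<^sub>n + q\<^sub>n\<^sub>-\<^sub>1 x\<close> with \<open>q\<^sub>k\<close> the denominator of \<open>[b\<^sub>1, \<dots>, b\<^sub>k]\<close>; the
  accumulators \<open>u\<close> and \<open>v\<close> run through the pairs of consecutive denominators.\<close>

primrec cf_denom :: "nat list \<Rightarrow> real \<Rightarrow> real \<Rightarrow> real \<Rightarrow> real" where
  "cf_denom [] u v x = u + v * x"
| "cf_denom (a # w) u v x = cf_denom w (real a * u + v) u x"

definition words :: "nat \<Rightarrow> nat set \<Rightarrow> nat list set" where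
  "words n A = {w. length w = n \<and> set w \<subseteq> A}"

lemma cf_map_nonneg: "0 \<le> x \<Longrightarrow> 0 \<le> cf_map w x"
  by (induction w) auto

lemma cf_map_le_half:
  assumes "set w \<subseteq> {2..}" "0 \<le> x" "x \<le> 1 / 2"
  shows "cf_map w x \<le> 1 / 2"
proof (cases w)
  case (Cons a w')
  have "2 \<le> real a" using assms(1) Cons by auto
  then show ?thesis using Cons cf_map_nonneg[OF assms(2), of w'] by (simp add: field_simps)
qed (use assms in auto)

text \<open>\<open>cf_denom\<close> is linear in the accumulators, and \<open>cf_map w x\<close> is
  the ratio of the two coefficients. With \<open>u = a\<close> and \<open>v = 1\<close> this splits
  the first digit off a continuant.\<close>

lemma cf_denom_eq_product:
  assumes "set w \<subseteq> {1..}" "0 \<le> x"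
  shows "cf_denom w u v x = (u + v * cf_map w x) * cf_denom w 1 0 x"
  using assms(1)
proof (induction w arbitrary: u v)
  case (Cons a w)
  define y where "y = cf_map w x"
  have "0 \<le> y" unfolding y_def using assms(2) by (rule cf_map_nonneg)
  moreover have "1 \<le> real a" using Cons.prems by auto
  ultimately have pos: "0 < real a + y" by linarith
  have *: "cf_denom w u v x = (u + v * y) * cf_denom w 1 0 x" for u v
    using Cons.IH[of u v] Cons.prems by (simp add: y_def)
  have "cf_denom (a # w) 1 0 x = (real a + y) * cf_denom w 1 0 x"
    "cf_denom (a # w) u v x = (real a * u + v + u * y) * cf_denom w 1 0 x"
    "cf_map (a # w) x = 1 / (real a + y)"
    using *[of "real a * u + v" u] *[of "real a" 1] by (simp_all add: y_def)
  moreover have "(u + v * (1 / (real a + y))) * (real a + y) = real a * u + v + u * y"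
    using pos by (simp add: field_simps)
  ultimately show ?case by (metis mult.assoc)
qed simp

text \<open>The order \<open>v \<le> u\<close> persists from digit to digit, and at the end
  \<open>u + v * x\<close> lies between \<open>u\<close> and \<open>2 * u\<close>.\<close>

lemma cf_denom_bounds:
  assumes "set w \<subseteq> {1..}" "0 \<le> v" "v \<le> u" "0 \<le> x" "x \<le> 1"
  shows "cf_denom w u v 0 \<le> cf_denom w u v x" "cf_denom w u v x \<le> 2 * cf_denom w u v 0"
proof -
  have "cf_denom w u v 0 \<le> cf_denom w u v x \<and> cf_denom w u v x \<le> 2 * cf_denom w u v 0"
    using assms(1-3)
  proof (induction w arbitrary: u v)
    case Nil
    then show ?case using assms(4,5) mult_left_le[of x v] by simp
  next
    case (Cons a w)
    then have "1 * u \<le> real a * u" by (intro mult_right_mono) auto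
    then show ?case using Cons by simp
  qed
  then show "cf_denom w u v 0 \<le> cf_denom w u v x" "cf_denom w u v x \<le> 2 * cf_denom w u v 0"
    by auto
qed

lemma cf_denom_ge:
  assumes "set w \<subseteq> {2..}" "0 \<le> v" "0 \<le> u"
  shows "2 ^ length w * u \<le> cf_denom w u v 0"
  using assms
proof (induction w arbitrary: u v)
  case (Cons a w)
  then have "2 * u \<le> real a * u + v" using mult_right_mono[of 2 "real a" u] by simp
  then have "2 ^ length w * (2 * u) \<le> 2 ^ length w * (real a * u + v)" by simp
  also have "\<dots> \<le> cf_denom w (real a * u + v) u 0" using Cons by (intro Cons.IH) auto
  finally show ?case by simp
qed simp

lemma cf_denom_0_ge_one:
  assumes "set w \<subseteq> {2..}"
  shows "2 ^ length w \<le> cf_denom w 1 0 0"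
  using cf_denom_ge[OF assms, of 0 1] by simp

text \<open>The difference formula of a Moebius transformation with determinant 1 or -1 whose
  denominator at \<open>x\<close> is \<open>cf_denom w 1 0 x\<close>.\<close>

lemma cf_map_diff:
  assumes "set w \<subseteq> {1..}" "0 \<le> x" "0 \<le> y"
  shows "\<bar>cf_map w x - cf_map w y\<bar> * (cf_denom w 1 0 x * cf_denom w 1 0 y) = \<bar>x - y\<bar>"
  using assms(1)
proof (induction w)
  case (Cons a w)
  define X where "X = cf_map w x"
  define Y where "Y = cf_map w y"
  define p where "p = cf_denom w 1 0 x"
  define q where "q = cf_denom w 1 0 y"
  have a: "1 \<le> real a" using Cons.prems by auto
  have pos: "0 < real a + X" "0 < real a + Y"
    using a cf_map_nonneg[OF assms(2), of w] cf_map_nonneg[OF assms(3), of w]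
    unfolding X_def Y_def by linarith+
  have w: "set w \<subseteq> {1..}" using Cons.prems by auto
  have "1 / (real a + X) - 1 / (real a + Y) = (Y - X) / ((real a + X) * (real a + Y))"
    using pos by (simp add: field_simps)
  then have "\<bar>1 / (real a + X) - 1 / (real a + Y)\<bar> * ((real a + X) * (real a + Y)) = \<bar>X - Y\<bar>"
    using pos by (simp add: abs_mult abs_minus_commute)
  moreover have "cf_denom (a # w) 1 0 x = (real a + X) * p" "cf_denom (a # w) 1 0 y = (real a + Y) * q"
    using cf_denom_eq_product[OF w assms(2), of "real a" 1] cf_denom_eq_product[OF w assms(3), of "real a" 1]
    by (simp_all add: X_def Y_def p_def q_def)
  ultimately show ?case
    using Cons.IH[OF w] unfolding cf_map.simps X_def[symmetric] Y_def[symmetric] p_def[symmetric] q_def[symmetric]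
    by (simp add: mult_ac)
qed simp

text \<open>The 4 is the factor 2 of \<open>cf_denom_bounds\<close>, lost once at \<open>x\<close>
  and once at \<open>y\<close>.\<close>

lemma cf_map_diff_le:
  assumes w: "set w \<subseteq> {2..}" and x: "0 \<le> x" "x \<le> 1" and y: "0 \<le> y" "y \<le> 1"
  shows "\<bar>cf_map w x - cf_map w y\<bar> \<le> \<bar>x - y\<bar> / (cf_denom w 1 0 0)\<^sup>2"
    and "\<bar>x - y\<bar> / (4 * (cf_denom w 1 0 0)\<^sup>2) \<le> \<bar>cf_map w x - cf_map w y\<bar>"
proof -
  have w': "set w \<subseteq> {1..}" using w by auto
  define q where "q = cf_denom w 1 0 0"
  define p where "p = cf_denom w 1 0 x * cf_denom w 1 0 y"
  have q: "0 < q" using cf_denom_0_ge_one[OF w] unfolding q_def by (smt (verit) zero_less_power)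
  have b: "q \<le> cf_denom w 1 0 x" "cf_denom w 1 0 x \<le> 2 * q" "q \<le> cf_denom w 1 0 y" "cf_denom w 1 0 y \<le> 2 * q"
    unfolding q_def using cf_denom_bounds[OF w', of 0 1] x y by auto
  have "q * q \<le> p" unfolding p_def using b q by (intro mult_mono) auto
  moreover have "p \<le> (2 * q) * (2 * q)" unfolding p_def using b q by (intro mult_mono) auto
  moreover have "\<bar>cf_map w x - cf_map w y\<bar> * p = \<bar>x - y\<bar>"
    unfolding p_def using cf_map_diff[OF w' x(1) y(1)] .
  moreover have "0 < p" using \<open>q * q \<le> p\<close> q by (smt (verit) mult_pos_pos)
  ultimately have p: "q\<^sup>2 \<le> p" "p \<le> 4 * q\<^sup>2" "\<bar>cf_map w x - cf_map w y\<bar> = \<bar>x - y\<bar> / p" "0 < p"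
    by (simp_all add: power2_eq_square eq_divide_eq)
  show "\<bar>cf_map w x - cf_map w y\<bar> \<le> \<bar>x - y\<bar> / (cf_denom w 1 0 0)\<^sup>2"
    unfolding q_def[symmetric] p(3) using p(1,2,4) q by (intro divide_left_mono) simp_all
  show "\<bar>x - y\<bar> / (4 * (cf_denom w 1 0 0)\<^sup>2) \<le> \<bar>cf_map w x - cf_map w y\<bar>"
    unfolding q_def[symmetric] p(3) using p(1,2,4) q by (intro divide_left_mono) simp_all
qed

section \<open>Self-similarity, separation and compactness of the limit set\<close>

lemma cf_set_bounds:
  assumes "A \<subseteq> {2..}" "x \<in> cf_set A"
  shows "0 \<le> x" "x \<le> 1 / 2"
proof -
  obtain b where b: "x = cfrac b" "\<And>i. b i \<in> A" using assms(2) by (auto simp: cf_set_def)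
  then have "\<forall>i. 2 \<le> b i" using assms(1) by fastforce
  then show "0 \<le> x" "x \<le> 1 / 2" using b cfrac_bounds[of b] by auto
qed

lemma cf_map_image_subset:
  assumes "A \<subseteq> {2..}" "set w \<subseteq> A"
  shows "cf_map w ` cf_set A \<subseteq> cf_set A"
  using assms(2)
proof (induction w)
  case (Cons a w)
  show ?case
  proof
    fix z assume "z \<in> cf_map (a # w) ` cf_set A"
    then obtain y where y: "y \<in> cf_map w ` cf_set A" "z = 1 / (real a + y)" by auto
    then have "y \<in> cf_set A" using Cons by auto
    then obtain b where b: "y = cfrac b" "\<And>i. b i \<in> A" by (auto simp: cf_set_def)
    define b' where "b' = (\<lambda>i. case i of 0 \<Rightarrow> a | Suc j \<Rightarrow> b j)"
    have b': "b' i \<in> A" for i using Cons.prems b(2) by (auto simp: b'_def split: nat.split)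
    then have "\<forall>i. 2 \<le> b' i" using assms(1) by fastforce
    from cfrac_Suc[OF this] have "cfrac b' = z" unfolding y(2) b(1) by (simp add: b'_def)
    then show "z \<in> cf_set A" using b' by (auto simp: cf_set_def)
  qed
qed simp

lemma cf_set_eq_UN_words:
  assumes "A \<subseteq> {2..}"
  shows "cf_set A \<subseteq> (\<Union>w\<in>words n A. cf_map w ` cf_set A)"
proof (induction n)
  case 0
  then show ?case by (simp add: words_def)
next
  case (Suc n)
  show ?case
  proof
    fix x assume "x \<in> cf_set A"
    then obtain b where b: "x = cfrac b" "\<And>i. b i \<in> A" by (auto simp: cf_set_def)
    then have "\<forall>i. 2 \<le> b i" using assms by fastforce
    from cfrac_Suc[OF this] have x: "x = 1 / (real (b 0) + cfrac (\<lambda>i. b (Suc i)))"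
      using b by simp
    have "cfrac (\<lambda>i. b (Suc i)) \<in> cf_set A" using b by (auto simp: cf_set_def)
    then obtain w y where "w \<in> words n A" "y \<in> cf_set A" "cfrac (\<lambda>i. b (Suc i)) = cf_map w y"
      using Suc by blast
    then show "x \<in> (\<Union>w\<in>words (Suc n) A. cf_map w ` cf_set A)"
      using x b by (intro UN_I[of "b 0 # w"]) (auto simp: words_def)
  qed
qed

text \<open>Values stay in [0, 1/2], so two equal sums of a digit and a value have equal digits.
  This excludes the ambiguity at common endpoints and makes the images of different words
  disjoint.\<close>

lemma cf_map_inject:
  assumes "length w = length w'" "set w \<subseteq> {2..}" "set w' \<subseteq> {2..}"
    and "0 \<le> x" "x \<le> 1 / 2" "0 \<le> y" "y \<le> 1 / 2" "cf_map w x = cf_map w' y"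
  shows "w = w'"
  using assms
proof (induction w w' rule: list_induct2)
  case (Cons a w a' w')
  define X where "X = cf_map w x"
  define Y where "Y = cf_map w' y"
  have "0 \<le> X" "X \<le> 1 / 2" "0 \<le> Y" "Y \<le> 1 / 2"
    unfolding X_def Y_def using Cons.prems cf_map_nonneg cf_map_le_half by auto
  moreover have "real a + X = real a' + Y"
    using Cons.prems(7) by (simp add: X_def Y_def)
  ultimately have "\<bar>real a - real a'\<bar> < 1" by linarith
  then have "a = a'" by linarith
  moreover from this have "cf_map w x = cf_map w' y"
    using \<open>real a + X = real a' + Y\<close> by (simp add: X_def Y_def)
  then have "w = w'" using Cons.prems by (intro Cons.IH) simp_all
  ultimately show ?case by simp
qed simp

lemma continuous_on_cf_convergent: "continuous_on {b. \<forall>i. 2 \<le> b i} (cf_convergent n)"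
proof (induction n)
  case (Suc n)
  have tail: "continuous_on {b. \<forall>i. 2 \<le> b i} (\<lambda>b i. b (Suc i) :: nat)"
    by (intro continuous_on_coordinatewise_then_product continuous_on_subset[OF continuous_on_product_coordinates]) auto
  have "continuous_on {b. \<forall>i. 2 \<le> b i} (\<lambda>b. cf_convergent n (\<lambda>i. b (Suc i)))"
    by (rule continuous_on_compose2[OF Suc tail]) auto
  moreover have "continuous_on {b. \<forall>i. 2 \<le> b i} (\<lambda>b. real (b 0))"
    by (rule continuous_on_compose2[of UNIV real _ "\<lambda>b. b 0"])
      (auto intro: continuous_on_subset[OF continuous_on_product_coordinates])
  moreover have "real (b 0) + cf_convergent n (\<lambda>i. b (Suc i)) \<noteq> 0" if "\<forall>i. 2 \<le> b i" for b
    using that[rule_format, of 0] cf_convergent_bounds(1)[of "\<lambda>i. b (Suc i)" n] that by fastforce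
  ultimately have "continuous_on {b. \<forall>i. 2 \<le> b i} (\<lambda>b. 1 / (real (b 0) + cf_convergent n (\<lambda>i. b (Suc i))))"
    by (intro continuous_on_divide continuous_on_add continuous_on_const) simp_all
  then show ?case by simp
qed simp

text \<open>The set is the image of the compact product space of digit sequences under
  \<open>cfrac\<close>, which is continuous as a uniform limit of convergents.\<close>

lemma compact_cf_set:
  assumes "finite A" "A \<subseteq> {2..}"
  shows "compact (cf_set A)"
proof -
  let ?S = "PiE UNIV (\<lambda>_. A) :: (nat \<Rightarrow> nat) set"
  have "compactin (product_topology (\<lambda>_. euclidean) UNIV) ?S"
    unfolding compactin_PiE using assms(1) by (simp add: finite_imp_compact)
  then have S: "compact ?S" by (simp add: euclidean_product_topology)
  have sub: "?S \<subseteq> {b. \<forall>i. 2 \<le> b i}" using assms(2) by force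
  have "uniform_limit ?S cf_convergent cfrac sequentially"
  proof (rule uniform_limitI)
    fix e :: real assume "0 < e"
    then obtain N where N: "(1 / 4 :: real) ^ N < e"
      using real_arch_pow_inv[of e "1 / 4"] by auto
    show "\<forall>\<^sub>F n in sequentially. \<forall>b\<in>?S. dist (cf_convergent n b) (cfrac b) < e"
    proof (rule eventually_sequentiallyI[of N], rule ballI)
      fix n b assume n: "N \<le> n" and b: "b \<in> ?S"
      have "dist (cf_convergent n b) (cfrac b) \<le> (1 / 4) ^ n"
        using cfrac_diff_convergent[of b n] b sub by (auto simp: dist_real_def abs_minus_commute)
      also have "\<dots> \<le> (1 / 4) ^ N" using n by (intro power_decreasing) auto
      finally show "dist (cf_convergent n b) (cfrac b) < e" using N by simp
    qed
  qed
  then have "continuous_on ?S cfrac"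
    using continuous_on_subset[OF continuous_on_cf_convergent sub]
    by (intro uniform_limit_theorem[of _ cf_convergent]) auto
  moreover have "cf_set A = cfrac ` ?S" by (auto simp: cf_set_def)
  ultimately show ?thesis using compact_continuous_image S by metis
qed

lemma continuous_on_cf_map:
  assumes "set w \<subseteq> {1..}"
  shows "continuous_on {0..} (cf_map w)"
  using assms
proof (induction w)
  case (Cons a w)
  have "real a + cf_map w x \<noteq> 0" if "0 \<le> x" for x
    using Cons.prems cf_map_nonneg[OF that, of w] by auto
  then show ?case using Cons by (simp, intro continuous_intros) auto
qed (simp add: continuous_on_id)

subsection \<open>Partition functions\<close>

lemma nn_integral_count_space_Times:
  assumes "countable A" "countable B"
  shows "(\<integral>\<^sup>+x. \<integral>\<^sup>+y. f (x, y) \<partial>count_space B \<partial>count_space A) = (\<integral>\<^sup>+p. f p \<partial>count_space (A \<times> B))"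
proof -
  interpret B: sigma_finite_measure "count_space B"
    using assms by (rule_tac sigma_finite_measure_count_space_countable)
  have "count_space A \<Otimes>\<^sub>M count_space B = count_space (A \<times> B)"
    by (rule pair_measure_countable) fact+
  then show ?thesis
    using B.nn_integral_fst[of f "count_space A"] by simp
qed

lemma nn_integral_count_space_mono:
  assumes "A \<subseteq> B" "\<And>x. x \<in> A \<Longrightarrow> f x \<le> g x"
  shows "(\<integral>\<^sup>+x. f x \<partial>count_space A) \<le> (\<integral>\<^sup>+x. g x \<partial>count_space B)"
proof -
  have "(\<integral>\<^sup>+x. f x \<partial>count_space A) = (\<integral>\<^sup>+x. f x * indicator A x \<partial>count_space UNIV)"
    by (simp add: nn_integral_count_space_indicator)
  also have "\<dots> \<le> (\<integral>\<^sup>+x. g x * indicator B x \<partial>count_space UNIV)"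
    using assms by (intro nn_integral_mono) (auto split: split_indicator)
  also have "\<dots> = (\<integral>\<^sup>+x. g x \<partial>count_space B)"
    by (simp add: nn_integral_count_space_indicator)
  finally show ?thesis .
qed

lemma nn_integral_count_space_insert_le:
  "(\<integral>\<^sup>+x. f x \<partial>count_space (insert c A)) \<le> (\<integral>\<^sup>+x. f x \<partial>count_space A) + f c"
proof -
  have "(\<integral>\<^sup>+x. f x \<partial>count_space (insert c A))
      = (\<integral>\<^sup>+x. f x * indicator (insert c A) x \<partial>count_space UNIV)"
    by (simp add: nn_integral_count_space_indicator)
  also have "\<dots> \<le> (\<integral>\<^sup>+x. f x * indicator A x + f x * indicator {c} x \<partial>count_space UNIV)"
    by (intro nn_integral_mono) (auto split: split_indicator)
  also have "\<dots> = (\<integral>\<^sup>+x. f x * indicator A x \<partial>count_space UNIV) + (\<integral>\<^sup>+x. f x * indicator {c} x \<partial>count_space UNIV)"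
    by (intro nn_integral_add) auto
  also have "\<dots> = (\<integral>\<^sup>+x. f x \<partial>count_space A) + f c"
    by (simp add: nn_integral_count_space_indicator nn_integral_indicator_singleton)
  finally show ?thesis .
qed

text \<open>\<open>cf_sum A s n 1 0\<close> is the partition function \<open>\<Sum> q(w)\<^sup>-\<^sup>2\<^sup>s\<close> over the words \<open>w\<close> of length \<open>n\<close> in
  \<open>A\<close>; the accumulators are those of \<open>cf_denom\<close>.\<close>

primrec cf_sum :: "nat set \<Rightarrow> real \<Rightarrow> nat \<Rightarrow> real \<Rightarrow> real \<Rightarrow> ennreal" where
  "cf_sum A s 0 u v = ennreal (u powr (- 2 * s))"
| "cf_sum A s (Suc n) u v = (\<integral>\<^sup>+a. cf_sum A s n (real a * u + v) u \<partial>count_space A)"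

lemma words_Suc: "words (Suc n) A = (\<lambda>(a, w). a # w) ` (A \<times> words n A)"
  by (auto simp: words_def length_Suc_conv image_iff)

lemma countable_words: "countable (words n A)"
  by (rule countableI_type)

text \<open>The recursion suits inductions on the first digit; the form as one sum suits covers and
  comparisons word by word.\<close>

lemma cf_sum_eq_words:
  "cf_sum A s n u v = (\<integral>\<^sup>+w. ennreal (cf_denom w u v 0 powr (- 2 * s)) \<partial>count_space (words n A))"
proof (induction n arbitrary: u v)
  case 0
  have "words 0 A = {[]}" by (auto simp: words_def)
  then show ?case by (simp add: nn_integral_count_space_finite)
next
  case (Suc n)
  let ?F = "\<lambda>w. ennreal (cf_denom w u v 0 powr (- 2 * s))"
  have bij: "bij_betw (\<lambda>(a, w). a # w) (A \<times> words n A) (words (Suc n) A)"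
    unfolding words_Suc by (intro inj_on_imp_bij_betw) (auto simp: inj_on_def)
  have "cf_sum A s (Suc n) u v =
      (\<integral>\<^sup>+a. \<integral>\<^sup>+w. ?F (case (a, w) of (a, w) \<Rightarrow> a # w) \<partial>count_space (words n A) \<partial>count_space A)"
    by (simp add: Suc)
  also have "\<dots> = (\<integral>\<^sup>+p. ?F (case p of (a, w) \<Rightarrow> a # w) \<partial>count_space (A \<times> words n A))"
    by (rule nn_integral_count_space_Times) (auto intro: countable_words)
  also have "\<dots> = (\<integral>\<^sup>+w. ?F w \<partial>count_space (words (Suc n) A))"
    using nn_integral_bij_count_space[OF bij, of ?F] .
  finally show ?case .
qed

lemma cf_sum_mono:
  assumes "A \<subseteq> B"
  shows "cf_sum A s n u v \<le> cf_sum B s n u v"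
  unfolding cf_sum_eq_words using assms
  by (intro nn_integral_count_space_mono) (auto simp: words_def)

lemma powr_minus_antimono:
  fixes x y s :: real
  assumes "0 < x" "x \<le> y" "0 \<le> s"
  shows "y powr (- 2 * s) \<le> x powr (- 2 * s)"
  using assms by (intro powr_mono2') auto

lemma cf_sum_antimono:
  assumes "0 \<le> s" "0 < u" "u \<le> u'" "0 \<le> v" "v \<le> v'" "A \<subseteq> {1..}"
  shows "cf_sum A s n u' v' \<le> cf_sum A s n u v"
  using assms(2-5)
proof (induction n arbitrary: u u' v v')
  case 0
  then show ?case using assms(1) powr_minus_antimono[of u u' s] by (simp add: ennreal_leI)
next
  case (Suc n)
  show ?case unfolding cf_sum.simps
  proof (rule nn_integral_count_space_mono)
    fix a assume "a \<in> A"
    then have "1 \<le> real a" using assms(6) by auto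
    then have "0 < real a * u + v" using Suc.prems by (simp add: add_pos_nonneg)
    moreover have "real a * u + v \<le> real a * u' + v'"
      using Suc.prems by (intro add_mono mult_left_mono) auto
    ultimately show "cf_sum A s n (real a * u' + v') u' \<le> cf_sum A s n (real a * u + v) u"
      using Suc.prems by (intro Suc.IH) auto
  qed simp
qed

text \<open>Continuants are homogeneous of degree 1 in the accumulators.\<close>

lemma cf_sum_scale:
  assumes "0 < c"
  shows "cf_sum A s n (c * u) (c * v) = ennreal (c powr (- 2 * s)) * cf_sum A s n u v"
proof (induction n arbitrary: u v)
  case 0
  show ?case by (simp add: powr_mult ennreal_mult)
next
  case (Suc n)
  have "real a * (c * u) + c * v = c * (real a * u + v)" for a by (simp add: algebra_simps)
  then have "cf_sum A s (Suc n) (c * u) (c * v) =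
      (\<integral>\<^sup>+a. cf_sum A s n (c * (real a * u + v)) (c * u) \<partial>count_space A)"
    by simp
  also have "\<dots> = (\<integral>\<^sup>+a. ennreal (c powr (- 2 * s)) * cf_sum A s n (real a * u + v) u \<partial>count_space A)"
    by (simp only: Suc)
  also have "\<dots> = ennreal (c powr (- 2 * s)) * cf_sum A s (Suc n) u v"
    by (simp add: nn_integral_cmult)
  finally show ?case .
qed

lemma cf_sum_le_base:
  assumes "0 \<le> s" "0 < u" "0 \<le> v" "A \<subseteq> {1..}"
  shows "cf_sum A s n u v \<le> ennreal (u powr (- 2 * s)) * cf_sum A s n 1 0"
  using cf_sum_scale[OF assms(2), of A s n 1 0] cf_sum_antimono[of s u u 0 v A n] assms by simp

text \<open>Submultiplicativity, from \<open>q(w w') \<ge> q(w) q(w')\<close>: after the first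
  \<open>m\<close> digits, setting the second accumulator to 0 only lowers denominators, and the
  first one scales out.\<close>

lemma cf_sum_add_le:
  assumes "0 \<le> s" "0 < u" "0 \<le> v" "A \<subseteq> {1..}"
  shows "cf_sum A s (m + n) u v \<le> cf_sum A s m u v * cf_sum A s n 1 0"
  using assms(2,3)
proof (induction m arbitrary: u v)
  case 0
  then show ?case using cf_sum_le_base[OF assms(1) _ _ assms(4)] by simp
next
  case (Suc m)
  have "cf_sum A s (Suc m + n) u v
      \<le> (\<integral>\<^sup>+a. cf_sum A s m (real a * u + v) u * cf_sum A s n 1 0 \<partial>count_space A)"
    unfolding add_Suc cf_sum.simps
  proof (rule nn_integral_count_space_mono)
    fix a assume "a \<in> A"
    then have "1 \<le> real a" using assms(4) by auto
    then have "0 < real a * u + v" using Suc.prems by (simp add: add_pos_nonneg)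
    then show "cf_sum A s (m + n) (real a * u + v) u \<le> cf_sum A s m (real a * u + v) u * cf_sum A s n 1 0"
      using Suc.prems by (intro Suc.IH) auto
  qed simp
  also have "\<dots> = cf_sum A s (Suc m) u v * cf_sum A s n 1 0"
    by (simp add: nn_integral_multc)
  finally show ?case .
qed

lemma cf_sum_mult_le_power:
  assumes "0 \<le> s" "A \<subseteq> {1..}"
  shows "cf_sum A s (k * n) 1 0 \<le> cf_sum A s n 1 0 ^ k"
proof (induction k)
  case (Suc k)
  have "cf_sum A s (n + k * n) 1 0 \<le> cf_sum A s n 1 0 * cf_sum A s (k * n) 1 0"
    using assms by (intro cf_sum_add_le) auto
  also have "\<dots> \<le> cf_sum A s n 1 0 * cf_sum A s n 1 0 ^ k"
    using Suc by (rule mult_left_mono) simp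
  finally show ?case by simp
qed simp

text \<open>Because \<open>q(w) \<ge> 2\<^sup>n\<close>, lowering the exponent by \<open>e\<close>
  gains at least \<open>4\<^sup>n\<^sup>e\<close> per word. This exponential gain later absorbs the
  distortion constant.\<close>

lemma cf_sum_decrease_exponent:
  assumes "A \<subseteq> {2..}" "0 \<le> e"
  shows "ennreal (4 powr (real n * e)) * cf_sum A s n 1 0 \<le> cf_sum A (s - e) n 1 0"
proof -
  have "ennreal (4 powr (real n * e)) * cf_sum A s n 1 0
      = (\<integral>\<^sup>+w. ennreal (4 powr (real n * e)) * ennreal (cf_denom w 1 0 0 powr (- 2 * s)) \<partial>count_space (words n A))"
    unfolding cf_sum_eq_words by (simp add: nn_integral_cmult)
  also have "\<dots> \<le> cf_sum A (s - e) n 1 0"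
    unfolding cf_sum_eq_words
  proof (rule nn_integral_count_space_mono)
    fix w assume w: "w \<in> words n A"
    define q where "q = cf_denom w 1 0 0"
    have q: "2 ^ n \<le> q" using cf_denom_0_ge_one[of w] w assms(1) by (auto simp: q_def words_def)
    have "4 powr (real n * e) = (2 powr 2) powr (real n * e)" by simp
    also have "\<dots> = (2 ^ n) powr (2 * e)"
      by (simp only: powr_powr powr_realpow[symmetric] zero_less_numeral) (simp add: mult_ac)
    also have "\<dots> \<le> q powr (2 * e)" using q assms(2) by (intro powr_mono2) auto
    finally have "4 powr (real n * e) * q powr (- 2 * s) \<le> q powr (2 * e) * q powr (- 2 * s)"
      by (intro mult_right_mono) auto
    also have "\<dots> = q powr (- 2 * (s - e))"
      by (simp add: powr_add[symmetric] algebra_simps)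
    finally show "ennreal (4 powr (real n * e)) * ennreal (cf_denom w 1 0 0 powr (- 2 * s))
        \<le> ennreal (cf_denom w 1 0 0 powr (- 2 * (s - e)))"
      unfolding q_def[symmetric] by (simp add: ennreal_mult[symmetric] ennreal_leI)
  qed simp
  finally show ?thesis .
qed

text \<open>Monotone convergence along the truncated alphabets: a word has finitely many digits, so
  it is captured by one of them.\<close>

lemma cf_sum_finite_approx:
  assumes "x < cf_sum A s n u v"
  obtains D where "finite D" "D \<subseteq> A" "x < cf_sum D s n u v"
proof -
  let ?F = "\<lambda>w. ennreal (cf_denom w u v 0 powr (- 2 * s))"
  define D where "D m = A \<inter> {..<m}" for m :: nat
  have eq: "cf_sum B s n u v = (\<integral>\<^sup>+w. ?F w * indicator (words n B) w \<partial>count_space UNIV)" for B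
    unfolding cf_sum_eq_words by (simp add: nn_integral_count_space_indicator)
  have inc: "incseq (\<lambda>m w. ?F w * indicator (words n (D m)) w)"
    by (intro incseq_SucI le_funI mult_left_mono) (auto simp: words_def D_def split: split_indicator)
  have "?F w * indicator (words n A) w \<le> (SUP m. ?F w * indicator (words n (D m)) w)" for w
  proof (cases "w \<in> words n A")
    case True
    \<comment> \<open>\<open>insert 0\<close> takes care of the empty word, whose set of digits has
      no maximum.\<close>
    have "w \<in> words n (D (Suc (Max (insert 0 (set w)))))"
      using True by (auto simp: words_def D_def less_Suc_eq_le)
    then show ?thesis
      using True by (intro SUP_upper2[of "Suc (Max (insert 0 (set w)))"]) auto
  qed simp
  then have "cf_sum A s n u v \<le> (\<integral>\<^sup>+w. (SUP m. ?F w * indicator (words n (D m)) w) \<partial>count_space UNIV)"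
    unfolding eq by (intro nn_integral_mono)
  also have "\<dots> = (SUP m. cf_sum (D m) s n u v)"
    unfolding eq by (rule nn_integral_monotone_convergence_SUP[OF inc]) simp
  finally have "x < (SUP m. cf_sum (D m) s n u v)" using assms by simp
  then obtain m where "x < cf_sum (D m) s n u v" by (auto simp: less_SUP_iff)
  then show thesis by (intro that[of "D m"]) (auto simp: D_def)
qed

section \<open>Dimension bounds from partition functions\<close>

text \<open>The cover consists of the images of \<open>cf_set A\<close> under the words of length
  \<open>n\<close>, whose diameters are at most \<open>q(w)\<^sup>-\<^sup>2\<close>, hence at most
  \<open>(1 / 4) ^ n\<close>.\<close>

lemma hausdorff_premeasure_cf_set_le:
  assumes A: "A \<subseteq> {2..}" and s: "0 < s" and \<delta>: "(1 / 4) ^ n \<le> \<delta>"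
  shows "hausdorff_premeasure s \<delta> (cf_set A) \<le> cf_sum A s n 1 0"
proof -
  define P where "P w = cf_map w ` cf_set A" for w
  \<comment> \<open>Covers are indexed by \<open>nat\<close>: words enter through their codes, and
    all other indices receive the empty set, which contributes 0.\<close>
  define I where "I = (to_nat :: nat list \<Rightarrow> nat) ` words n A"
  define U where "U i = (if i \<in> I then P (from_nat i) else {})" for i
  have diam: "\<bar>x - y\<bar> \<le> 1 / (cf_denom w 1 0 0)\<^sup>2"
    if "w \<in> words n A" "x \<in> P w" "y \<in> P w" for w x y
  proof -
    obtain x' y' where xy: "x = cf_map w x'" "y = cf_map w y'" "x' \<in> cf_set A" "y' \<in> cf_set A"
      using \<open>x \<in> P w\<close> \<open>y \<in> P w\<close> unfolding P_def by auto
    have b: "0 \<le> x'" "x' \<le> 1 / 2" "0 \<le> y'" "y' \<le> 1 / 2" using xy cf_set_bounds[OF A] by auto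
    have "\<bar>x - y\<bar> \<le> \<bar>x' - y'\<bar> / (cf_denom w 1 0 0)\<^sup>2"
      using b that(1) A unfolding xy by (intro cf_map_diff_le(1)) (auto simp: words_def)
    also have "\<dots> \<le> 1 / (cf_denom w 1 0 0)\<^sup>2" using b by (intro divide_right_mono) auto
    finally show ?thesis .
  qed
  have q: "2 ^ n \<le> cf_denom w 1 0 0" if "w \<in> words n A" for w
    using that A cf_denom_0_ge_one[of w] by (auto simp: words_def)
  have diam_P: "diameter (P w) \<le> 1 / (cf_denom w 1 0 0)\<^sup>2" if "w \<in> words n A" for w
    using diam[OF that] by (intro diameter_le) (auto simp: dist_real_def)
  have bd: "bounded (P w)" if "w \<in> words n A" for w
  proof (cases "P w = {}")
    case False
    then obtain x where "x \<in> P w" by blast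
    then show ?thesis using diam[OF that]
      by (intro bounded_subset[OF bounded_cball, of _ x "1 / (cf_denom w 1 0 0)\<^sup>2"]) (auto simp: dist_real_def)
  qed simp
  have "hausdorff_premeasure s \<delta> (cf_set A) \<le> (\<Sum>i. diam_power s (U i))"
    unfolding hausdorff_premeasure_def
  proof (rule INF_lower, intro CollectI conjI allI)
    have "P w \<subseteq> (\<Union>i. U i)" if "w \<in> words n A" for w
      using that unfolding U_def I_def by (intro UN_upper[THEN subset_trans[rotated], of "to_nat w"]) auto
    then show "cf_set A \<subseteq> (\<Union>i. U i)"
      using cf_set_eq_UN_words[OF A, of n] unfolding P_def by (meson UN_least subset_trans)
    fix i
    show "bounded (U i)" using bd by (auto simp: U_def I_def)
    have "0 \<le> \<delta>" using \<delta> by (rule order_trans[rotated]) simp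
    show "diameter (U i) \<le> \<delta>"
    proof (cases "i \<in> I")
      case True
      then obtain w where w: "w \<in> words n A" "i = to_nat w" unfolding I_def by auto
      have "diameter (U i) \<le> 1 / (cf_denom w 1 0 0)\<^sup>2"
        using diam_P[OF w(1)] True w by (simp add: U_def)
      also have "\<dots> \<le> 1 / (2 ^ n)\<^sup>2"
        using power_mono[OF q[OF w(1)], of 2] by (intro frac_le) simp_all
      also have "\<dots> = (1 / 4) ^ n"
        by (simp add: power_one_over power_even_eq[symmetric] power_mult)
      finally show ?thesis using \<delta> by simp
    qed (use \<open>0 \<le> \<delta>\<close> in \<open>simp add: U_def\<close>)
  qed
  also have "\<dots> = (\<integral>\<^sup>+i. diam_power s (P (from_nat i)) * indicator I i \<partial>count_space UNIV)"
    unfolding nn_integral_count_space_nat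
    by (intro suminf_cong) (auto simp: U_def diam_power_def split: split_indicator)
  also have "\<dots> = (\<integral>\<^sup>+i. diam_power s (P (from_nat i)) \<partial>count_space I)"
    by (simp add: nn_integral_count_space_indicator)
  also have "\<dots> = (\<integral>\<^sup>+w. diam_power s (P (from_nat (to_nat w))) \<partial>count_space (words n A))"
    by (rule nn_integral_bij_count_space[symmetric])
      (auto simp: I_def intro!: inj_on_imp_bij_betw inj_on_subset[OF inj_to_nat])
  also have "\<dots> \<le> cf_sum A s n 1 0"
    unfolding cf_sum_eq_words
  proof (rule nn_integral_count_space_mono)
    fix w assume w: "w \<in> words n A"
    define q' where "q' = cf_denom w 1 0 0"
    have q': "0 < q'" unfolding q'_def using q[OF w] by (rule less_le_trans[rotated]) simp
    have "diameter (P w) powr s \<le> (1 / q'\<^sup>2) powr s"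
      using s diam_P[OF w] diameter_ge_0[OF bd[OF w]] unfolding q'_def by (intro powr_mono2) auto
    also have "\<dots> = q' powr (- 2 * s)"
    proof -
      have "1 / q'\<^sup>2 = q' powr (- 2)" using q' by (simp add: powr_minus powr_numeral divide_simps)
      then show ?thesis by (simp add: powr_powr)
    qed
    finally show "diam_power s (P (from_nat (to_nat w))) \<le> ennreal (cf_denom w 1 0 0 powr (- 2 * s))"
      using s unfolding diam_power_def q'_def[symmetric] by (auto intro: ennreal_leI)
  qed simp
  finally show ?thesis .
qed

text \<open>By submultiplicativity the sums at length \<open>k * n\<close> are at most the
  \<open>k\<close>-th powers of a number below 1, so the covers by longer words have sums tending to
  0.\<close>

lemma hausdorff_dim_cf_set_le:
  assumes A: "A \<subseteq> {2..}" and s: "0 < s" and n: "cf_sum A s n 1 0 < 1"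
  shows "hausdorff_dim (cf_set A) \<le> ennreal s"
proof -
  have A': "A \<subseteq> {1..}" using A by auto
  define r where "r = enn2real (cf_sum A s n 1 0)"
  have r: "cf_sum A s n 1 0 = ennreal r" "0 \<le> r" "r < 1"
    using n unfolding r_def by (cases "cf_sum A s n 1 0"; simp add: ennreal_less_one_iff)+
  \<comment> \<open>For \<open>n = 0\<close> the partition function is 1.\<close>
  have "0 < n" using n by (cases n) auto
  have "hausdorff_premeasure s \<delta> (cf_set A) = 0" if \<delta>: "0 < \<delta>" for \<delta>
  proof -
    have "eventually (\<lambda>k. (1 / 4 :: real) ^ k < \<delta>) sequentially"
      using order_tendstoD(2)[OF LIMSEQ_realpow_zero[of "1/4"] \<delta>] by simp
    then have "eventually (\<lambda>k. hausdorff_premeasure s \<delta> (cf_set A) \<le> ennreal (r ^ k)) sequentially"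
    proof eventually_elim
      case (elim k)
      have "(1 / 4 :: real) ^ (k * n) \<le> (1 / 4) ^ k"
        using \<open>0 < n\<close> by (intro power_decreasing) auto
      then have "hausdorff_premeasure s \<delta> (cf_set A) \<le> cf_sum A s (k * n) 1 0"
        using elim by (intro hausdorff_premeasure_cf_set_le A s) linarith
      also have "\<dots> \<le> cf_sum A s n 1 0 ^ k"
        using s A' by (intro cf_sum_mult_le_power) auto
      also have "\<dots> = ennreal (r ^ k)" using r by (simp add: ennreal_power)
      finally show ?case .
    qed
    moreover have "(\<lambda>k. ennreal (r ^ k)) \<longlonglongrightarrow> ennreal 0"
      using r by (intro tendsto_ennrealI LIMSEQ_realpow_zero) auto
    ultimately have "hausdorff_premeasure s \<delta> (cf_set A) \<le> ennreal 0"
      by (intro tendsto_lowerbound) auto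
    then show ?thesis by simp
  qed
  then have "hausdorff_measure s (cf_set A) = 0"
    unfolding hausdorff_measure_def by simp
  then show ?thesis
    using s unfolding hausdorff_dim_def by (intro Inf_lower) auto
qed

text \<open>The words of length \<open>n\<close> act as a self-similar system with ratios
  \<open>1 / (4 q(w)\<^sup>2)\<close>; the bound \<open>4 powr s\<close> compensates the 4 in these
  ratios.\<close>

lemma hausdorff_dim_cf_set_ge:
  assumes D: "finite D" "D \<subseteq> {2..}" and s: "0 < s"
    and n: "ennreal (4 powr s) \<le> cf_sum D s n 1 0"
  shows "ennreal s \<le> hausdorff_dim (cf_set D)"
proof (rule hausdorff_dim_ge_self_similar[where f = cf_map and W = "words n D"
      and c = "\<lambda>w. 1 / (4 * (cf_denom w 1 0 0)\<^sup>2)"])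
  have one: "1 < 4 powr s" using s by simp
  \<comment> \<open>Length 0 gives the value 1, which is below \<open>4 powr s\<close>; likewise an
    empty alphabet gives 0 for positive lengths.\<close>
  have "n \<noteq> 0" using n one by (intro notI) (simp add: ennreal_le_iff)
  then have "D \<noteq> {}" using n one by (intro notI) (cases n; simp add: nn_integral_count_space_finite)
  then show "cf_set D \<noteq> {}" by (auto simp: cf_set_def)
  show fin: "finite (words n D)"
    using finite_lists_length_eq[OF D(1), of n] by (simp add: words_def conj_commute)
  show "compact (cf_set D)" using D by (rule compact_cf_set)
  have w: "set w \<subseteq> D" "set w \<subseteq> {2..}" "set w \<subseteq> {1..}" "length w = n" if "w \<in> words n D" for w
    using that D(2) by (auto simp: words_def)
  have q: "1 \<le> cf_denom w 1 0 0" if "w \<in> words n D" for w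
    using cf_denom_0_ge_one[OF w(2)[OF that]] one_le_power[of "2::real" "length w"] by linarith
  show "cf_map w ` cf_set D \<subseteq> cf_set D" if "w \<in> words n D" for w
    using cf_map_image_subset[OF D(2) w(1)[OF that]] .
  show "continuous_on (cf_set D) (cf_map w)" if "w \<in> words n D" for w
    by (rule continuous_on_subset[OF continuous_on_cf_map[OF w(3)[OF that]]])
      (use cf_set_bounds[OF D(2)] in auto)
  show "0 < 1 / (4 * (cf_denom w 1 0 0)\<^sup>2)" if "w \<in> words n D" for w
    using q[OF that] by (simp add: power2_eq_square)
  show "1 / (4 * (cf_denom w 1 0 0)\<^sup>2) < 1" if "w \<in> words n D" for w
    using one_le_power[OF q[OF that], of 2] by (simp add: divide_less_eq_1)
  show "1 / (4 * (cf_denom w 1 0 0)\<^sup>2) * dist x y \<le> dist (cf_map w x) (cf_map w y)"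
    if "w \<in> words n D" "x \<in> cf_set D" "y \<in> cf_set D" for w x y
  proof -
    have b: "0 \<le> x" "x \<le> 1 / 2" "0 \<le> y" "y \<le> 1 / 2" using cf_set_bounds[OF D(2)] that by auto
    then have "\<bar>x - y\<bar> / (4 * (cf_denom w 1 0 0)\<^sup>2) \<le> \<bar>cf_map w x - cf_map w y\<bar>"
      by (intro cf_map_diff_le(2) w(2) that(1)) auto
    then show ?thesis by (simp add: dist_real_def)
  qed
  show "cf_map w ` cf_set D \<inter> cf_map w' ` cf_set D = {}"
    if "w \<in> words n D" "w' \<in> words n D" "w \<noteq> w'" for w w'
  proof (rule ccontr)
    assume "cf_map w ` cf_set D \<inter> cf_map w' ` cf_set D \<noteq> {}"
    then obtain x y where "x \<in> cf_set D" "y \<in> cf_set D" "cf_map w x = cf_map w' y" by auto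
    then have "w = w'"
      using that cf_set_bounds[OF D(2)] by (intro cf_map_inject[of w w' x y] w(2)) (auto simp: w(4))
    then show False using that by simp
  qed
  show "0 < s" by fact
  have pw: "(1 / (4 * (cf_denom w 1 0 0)\<^sup>2)) powr s = cf_denom w 1 0 0 powr (- 2 * s) / 4 powr s"
    if "w \<in> words n D" for w
  proof -
    define z where "z = cf_denom w 1 0 0"
    have "0 < z" using q[OF that] by (simp add: z_def)
    then have "z powr (- 2 * s) = (z\<^sup>2) powr (- s)"
      by (simp add: powr_powr flip: powr_numeral)
    then show ?thesis using \<open>0 < z\<close> unfolding z_def[symmetric]
      by (simp add: powr_divide powr_mult powr_minus_divide)
  qed
  have "ennreal (4 powr s) \<le> (\<Sum>w\<in>words n D. ennreal (cf_denom w 1 0 0 powr (- 2 * s)))"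
    using n unfolding cf_sum_eq_words by (simp add: nn_integral_count_space_finite[OF fin])
  then have "4 powr s \<le> (\<Sum>w\<in>words n D. cf_denom w 1 0 0 powr (- 2 * s))"
    by (simp add: sum_ennreal sum_nonneg)
  then show "1 \<le> (\<Sum>w\<in>words n D. (1 / (4 * (cf_denom w 1 0 0)\<^sup>2)) powr s)"
    by (simp add: pw sum_divide_distrib[symmetric])
qed

lemma hausdorff_dim_cf_set_finite_subset:
  assumes A: "A \<subseteq> {2..}" and s: "0 < t" "t < s" and n: "\<And>n. 1 \<le> cf_sum A s n 1 0"
  obtains D where "finite D" "D \<subseteq> A" "ennreal t \<le> hausdorff_dim (cf_set D)"
proof -
  \<comment> \<open>With this \<open>n\<close> the gain \<open>4 powr (n * (s - t))\<close> exceeds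
    the distortion constant \<open>4 powr t\<close>.\<close>
  obtain n where "t / (s - t) < real n" using reals_Archimedean2 by blast
  then have "4 powr t < 4 powr (real n * (s - t))"
    using s by (intro powr_less_mono) (auto simp: field_simps)
  then have "ennreal (4 powr t) < ennreal (4 powr (real n * (s - t))) * 1"
    by (simp add: ennreal_less_iff)
  also have "\<dots> \<le> ennreal (4 powr (real n * (s - t))) * cf_sum A s n 1 0"
    by (intro mult_left_mono n) simp
  also have "\<dots> \<le> cf_sum A t n 1 0"
    using cf_sum_decrease_exponent[OF A, of "s - t" n s] s by simp
  finally obtain D where "finite D" "D \<subseteq> A" "ennreal (4 powr t) < cf_sum D t n 1 0"
    by (rule cf_sum_finite_approx)
  then show thesis
    using A s hausdorff_dim_cf_set_ge[of D t n] by (intro that[of D]) (auto intro: less_imp_le)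
qed

subsection \<open>Changing a digit\<close>

text \<open>For a word with prefix \<open>w\<close> the continuant is \<open>k p + r\<close> in the digit \<open>k\<close> following \<open>w\<close>, with
  \<open>p, r \<ge> 0\<close>, and \<open>r\<close> only helps: \<open>(c p + r) / (k p + r) \<ge> c / k\<close> for \<open>c \<le> k\<close>. So no distortion enters.\<close>

lemma cf_sum_compare_digit:
  assumes s: "0 \<le> s" and A: "A \<subseteq> {1..}" and c: "1 \<le> c" and T: "T \<subseteq> {c..}"
    and weight: "ennreal (real c powr (- 2 * s)) \<le> (\<integral>\<^sup>+k. ennreal (real k powr (- 2 * s)) \<partial>count_space T)"
    and "0 < p" "0 \<le> r" "0 \<le> p'" "0 \<le> r'"
  shows "cf_sum A s n (real c * p + r) (real c * p' + r')
    \<le> (\<integral>\<^sup>+k. cf_sum A s n (real k * p + r) (real k * p' + r') \<partial>count_space T)"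
  using assms(6-)
proof (induction n arbitrary: p r p' r')
  case 0
  define z where "z = real c * p + r"
  have z: "0 < z" using 0 c by (simp add: z_def add_pos_nonneg)
  \<comment> \<open>\<open>K\<close> is the power of \<open>z / c\<close> with exponent
    \<open>- 2 * s\<close>, so it remains to see \<open>k p + r \<le> k z / c\<close> for each
    \<open>k\<close>.\<close>
  define K where "K = real c powr (2 * s) * z powr (- 2 * s)"
  have "K * real c powr (- 2 * s) = (real c powr (2 * s) * real c powr (- 2 * s)) * z powr (- 2 * s)"
    by (simp add: K_def)
  also have "\<dots> = z powr (- 2 * s)" using c by (simp add: powr_add[symmetric])
  finally have "ennreal (z powr (- 2 * s)) = ennreal K * ennreal (real c powr (- 2 * s))"
    by (simp add: ennreal_mult[symmetric] K_def)
  also have "\<dots> \<le> ennreal K * (\<integral>\<^sup>+k. ennreal (real k powr (- 2 * s)) \<partial>count_space T)"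
    by (intro mult_left_mono weight) simp
  also have "\<dots> = (\<integral>\<^sup>+k. ennreal K * ennreal (real k powr (- 2 * s)) \<partial>count_space T)"
    by (simp add: nn_integral_cmult)
  also have "\<dots> \<le> (\<integral>\<^sup>+k. ennreal ((real k * p + r) powr (- 2 * s)) \<partial>count_space T)"
  proof (rule nn_integral_count_space_mono)
    fix k assume "k \<in> T"
    then have k: "c \<le> k" using T by auto
    then have "real c * (real k * p + r) \<le> real k * z"
      using 0 mult_right_mono[of "real c" "real k" r] by (simp add: z_def algebra_simps)
    moreover have "0 < real k * p + r" using 0 c k by (simp add: add_pos_nonneg)
    ultimately have "(real k * z) powr (- 2 * s) \<le> (real c * (real k * p + r)) powr (- 2 * s)"
      using c s by (intro powr_minus_antimono) auto
    then have "real c powr (2 * s) * (real k powr (- 2 * s) * z powr (- 2 * s))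
        \<le> real c powr (2 * s) * (real c powr (- 2 * s) * (real k * p + r) powr (- 2 * s))"
      by (intro mult_left_mono) (simp_all add: powr_mult)
    also have "\<dots> = (real c powr (2 * s) * real c powr (- 2 * s)) * (real k * p + r) powr (- 2 * s)"
      by simp
    also have "\<dots> = (real k * p + r) powr (- 2 * s)" using c by (simp add: powr_add[symmetric])
    finally have "K * real k powr (- 2 * s) \<le> (real k * p + r) powr (- 2 * s)"
      by (simp add: K_def mult_ac)
    then show "ennreal K * ennreal (real k powr (- 2 * s)) \<le> ennreal ((real k * p + r) powr (- 2 * s))"
      by (simp add: ennreal_mult[symmetric] K_def ennreal_leI)
  qed simp
  finally show ?case by (simp add: z_def)
next
  case (Suc n)
  interpret pair_sigma_finite "count_space T" "count_space A"
    by (intro pair_sigma_finite.intro sigma_finite_measure_count_space_countable) auto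
  \<comment> \<open>Both accumulators are affine in the exchanged digit \<open>k\<close>. A further
    digit \<open>a\<close> preserves this form, replacing \<open>(p, r, p', r')\<close> by
    \<open>(a p + p', a r + r', p, r)\<close>.\<close>
  have swap: "real a * (real k * p + r) + (real k * p' + r') = real k * (real a * p + p') + (real a * r + r')"
    for a k by (simp add: algebra_simps)
  have "cf_sum A s (Suc n) (real c * p + r) (real c * p' + r') =
      (\<integral>\<^sup>+a. cf_sum A s n (real c * (real a * p + p') + (real a * r + r')) (real c * p + r) \<partial>count_space A)"
    unfolding cf_sum.simps swap ..
  also have "\<dots> \<le> (\<integral>\<^sup>+a. \<integral>\<^sup>+k. cf_sum A s n (real k * (real a * p + p') + (real a * r + r')) (real k * p + r)
        \<partial>count_space T \<partial>count_space A)"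
  proof (rule nn_integral_count_space_mono)
    fix a assume "a \<in> A"
    then have "1 \<le> real a" using A by auto
    then show "cf_sum A s n (real c * (real a * p + p') + (real a * r + r')) (real c * p + r)
      \<le> (\<integral>\<^sup>+k. cf_sum A s n (real k * (real a * p + p') + (real a * r + r')) (real k * p + r) \<partial>count_space T)"
      using Suc.prems by (intro Suc.IH) (auto intro!: add_pos_nonneg)
  qed simp
  also have "\<dots> = (\<integral>\<^sup>+k. \<integral>\<^sup>+a. cf_sum A s n (real k * (real a * p + p') + (real a * r + r')) (real k * p + r)
        \<partial>count_space A \<partial>count_space T)"
    by (rule Fubini') (simp add: pair_measure_countable)
  also have "\<dots> = (\<integral>\<^sup>+k. cf_sum A s (Suc n) (real k * p + r) (real k * p' + r') \<partial>count_space T)"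
    unfolding cf_sum.simps swap ..
  finally show ?case .
qed

text \<open>Occurrences of \<open>c\<close> are exchanged one position at a time: the induction
  hypothesis treats everything after the first digit, \<open>cf_sum_compare_digit\<close> the first
  digit itself.\<close>

lemma cf_sum_replace_digit:
  assumes s: "0 \<le> s" and B: "B \<subseteq> {1..}" and c: "1 \<le> c" and T: "T \<subseteq> {c..}" and disj: "B \<inter> T = {}"
    and weight: "ennreal (real c powr (- 2 * s)) \<le> (\<integral>\<^sup>+k. ennreal (real k powr (- 2 * s)) \<partial>count_space T)"
    and "0 < u" "0 \<le> v"
  shows "cf_sum (insert c B) s n u v \<le> cf_sum (B \<union> T) s n u v"
  using assms(7-)
proof (induction n arbitrary: u v)
  case (Suc n)
  have BT: "B \<union> T \<subseteq> {1..}" using B T c by auto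
  let ?f = "\<lambda>a. cf_sum (B \<union> T) s n (real a * u + v) u"
  have "cf_sum (insert c B) s (Suc n) u v \<le> (\<integral>\<^sup>+a. ?f a \<partial>count_space (insert c B))"
    unfolding cf_sum.simps
  proof (rule nn_integral_count_space_mono)
    fix a assume "a \<in> insert c B"
    then have "1 \<le> real a" using B c by auto
    then show "cf_sum (insert c B) s n (real a * u + v) u \<le> ?f a"
      using Suc.prems by (intro Suc.IH) (auto intro!: add_pos_nonneg)
  qed simp
  also have "\<dots> \<le> (\<integral>\<^sup>+a. ?f a \<partial>count_space B) + ?f c"
    by (rule nn_integral_count_space_insert_le)
  \<comment> \<open>After a digit \<open>k\<close> the accumulators are \<open>k u + v\<close> and
    \<open>u\<close>, which is the case \<open>p = u\<close>, \<open>r = v\<close>,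
    \<open>p' = 0\<close>, \<open>r' = u\<close>.\<close>
  also have "\<dots> \<le> (\<integral>\<^sup>+a. ?f a \<partial>count_space B) + (\<integral>\<^sup>+a. ?f a \<partial>count_space T)"
    using cf_sum_compare_digit[OF s BT c T weight, of u v 0 u n] Suc.prems
    by (intro add_left_mono) simp
  also have "\<dots> = (\<integral>\<^sup>+a. ?f a * indicator B a + ?f a * indicator T a \<partial>count_space UNIV)"
    by (subst nn_integral_add) (simp_all add: nn_integral_count_space_indicator)
  also have "\<dots> = (\<integral>\<^sup>+a. ?f a * indicator (B \<union> T) a \<partial>count_space UNIV)"
    using disj by (intro nn_integral_cong) (auto split: split_indicator)
  also have "\<dots> = cf_sum (B \<union> T) s (Suc n) u v"
    by (simp add: nn_integral_count_space_indicator)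
  finally show ?case .
qed simp

section \<open>Adding a large digit\<close>

text \<open>A word that uses \<open>c\<close> has continuant at least \<open>c u\<close>, which
  yields the error term. \<open>K\<close> must not depend on \<open>c\<close>, \<open>u\<close> or
  \<open>v\<close>: the induction changes the accumulators, and \<open>c\<close> is sent to infinity
  afterwards.\<close>

lemma cf_sum_insert_le:
  assumes s: "0 \<le> s" and F: "F \<subseteq> {1..}" and A: "A \<subseteq> F"
    and M: "cf_sum F s 1 1 0 < \<infinity>"
  shows "\<exists>K<\<infinity>. \<forall>c\<in>F. \<forall>u>0. \<forall>v\<ge>0. cf_sum (insert c A) s n u v
           \<le> cf_sum A s n u v + K * ennreal ((real c * u) powr (- 2 * s))"
proof (induction n)
  case 0
  show ?case by (intro exI[of _ 0]) simp
next
  case (Suc n)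
  then obtain K where K: "K < \<infinity>" "\<And>c u v. c \<in> F \<Longrightarrow> 0 < u \<Longrightarrow> 0 \<le> v \<Longrightarrow> cf_sum (insert c A) s n u v
           \<le> cf_sum A s n u v + K * ennreal ((real c * u) powr (- 2 * s))" by blast
  define L where "L = cf_sum F s 1 1 0"
  have Ln: "cf_sum F s n 1 0 \<le> L ^ n"
    using cf_sum_mult_le_power[OF s F, of n 1] by (simp add: L_def)
  show ?case
  proof (intro exI[of _ "K * L + L ^ n"] conjI ballI allI impI)
    show "K * L + L ^ n < \<infinity>"
      using K(1) M unfolding L_def[symmetric] by (simp add: ennreal_mult_less_top power_less_top_ennreal)
    fix c :: nat and u v :: real assume c: "c \<in> F" and uv: "0 < u" "0 \<le> v"
    define z where "z = (real c * u) powr (- 2 * s)"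
    have c1: "1 \<le> real c" using c F by auto
    \<comment> \<open>Words starting in \<open>A\<close>: the error terms carry an extra weight of
      the first digit, and these weights sum to at most \<open>L\<close>.\<close>
    have "(\<integral>\<^sup>+a. cf_sum (insert c A) s n (real a * u + v) u \<partial>count_space A)
        \<le> (\<integral>\<^sup>+a. cf_sum A s n (real a * u + v) u + K * ennreal z * ennreal (real a powr (- 2 * s)) \<partial>count_space A)"
    proof (rule nn_integral_count_space_mono)
      fix a assume "a \<in> A"
      then have a: "1 \<le> real a" using A F by auto
      then have "0 < real a * u + v" using uv by (simp add: add_pos_nonneg)
      then have "cf_sum (insert c A) s n (real a * u + v) u
          \<le> cf_sum A s n (real a * u + v) u + K * ennreal ((real c * (real a * u + v)) powr (- 2 * s))"
        using K(2)[OF c] uv by simp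
      also have "(real c * (real a * u + v)) powr (- 2 * s) \<le> (real c * u * real a) powr (- 2 * s)"
        using s c1 a uv by (intro powr_minus_antimono) (auto simp: algebra_simps)
      also have "\<dots> = z * real a powr (- 2 * s)"
        by (simp add: z_def powr_mult)
      finally show "cf_sum (insert c A) s n (real a * u + v) u
          \<le> cf_sum A s n (real a * u + v) u + K * ennreal z * ennreal (real a powr (- 2 * s))"
        by (simp add: ennreal_mult z_def mult.assoc mult_left_mono add_left_mono ennreal_leI)
    qed simp
    also have "\<dots> = cf_sum A s (Suc n) u v + K * ennreal z * (\<integral>\<^sup>+a. ennreal (real a powr (- 2 * s)) \<partial>count_space A)"
      by (simp add: nn_integral_add nn_integral_cmult)
    also have "\<dots> \<le> cf_sum A s (Suc n) u v + K * ennreal z * L"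
      unfolding L_def using A by (intro add_left_mono mult_left_mono) (simp_all add: nn_integral_count_space_mono)
    finally have rest: "(\<integral>\<^sup>+a. cf_sum (insert c A) s n (real a * u + v) u \<partial>count_space A)
        \<le> cf_sum A s (Suc n) u v + K * ennreal z * L" .
    \<comment> \<open>Words starting with \<open>c\<close>: the remaining \<open>n\<close> digits
      contribute at most \<open>L ^ n\<close> after scaling out \<open>c u\<close>.\<close>
    have "cf_sum (insert c A) s n (real c * u + v) u \<le> cf_sum F s n (real c * u) 0"
    proof (rule order_trans[OF cf_sum_mono])
      show "insert c A \<subseteq> F" using A c by simp
      show "cf_sum F s n (real c * u + v) u \<le> cf_sum F s n (real c * u) 0"
        using c1 uv s F by (intro cf_sum_antimono) simp_all
    qed
    also have "\<dots> \<le> ennreal z * L ^ n"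
      unfolding z_def using c1 uv s F Ln
      by (intro order_trans[OF cf_sum_le_base] mult_left_mono) auto
    finally have new: "cf_sum (insert c A) s n (real c * u + v) u \<le> ennreal z * L ^ n" .
    have "cf_sum (insert c A) s (Suc n) u v
        \<le> (\<integral>\<^sup>+a. cf_sum (insert c A) s n (real a * u + v) u \<partial>count_space A) + cf_sum (insert c A) s n (real c * u + v) u"
      unfolding cf_sum.simps by (rule nn_integral_count_space_insert_le)
    also have "\<dots> \<le> (cf_sum A s (Suc n) u v + K * ennreal z * L) + ennreal z * L ^ n"
      using rest new by (rule add_mono)
    also have "\<dots> = cf_sum A s (Suc n) u v + (K * L + L ^ n) * ennreal z"
      by (simp only: distrib_left add.assoc mult.assoc mult.commute[of _ "ennreal z"])
    finally show "cf_sum (insert c A) s (Suc n) u v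
        \<le> cf_sum A s (Suc n) u v + (K * L + L ^ n) * ennreal ((real c * u) powr (- 2 * s))"
      unfolding z_def .
  qed
qed

text \<open>For fixed \<open>n\<close> the error of \<open>cf_sum_insert_le\<close> tends to 0 as
  \<open>c\<close> grows, so a strict inequality survives.\<close>

lemma cf_sum_insert_less_one:
  assumes s: "0 < s" and F: "F \<subseteq> {1..}" and A: "A \<subseteq> F"
    and M: "cf_sum F s 1 1 0 < \<infinity>" and n: "cf_sum A s n 1 0 < 1"
  shows "\<exists>N. \<forall>c\<in>F. N \<le> c \<longrightarrow> cf_sum (insert c A) s n 1 0 < 1"
proof -
  obtain K where K: "K < \<infinity>" "\<forall>c\<in>F. \<forall>u>0. \<forall>v\<ge>0. cf_sum (insert c A) s n u v
           \<le> cf_sum A s n u v + K * ennreal ((real c * u) powr (- 2 * s))"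
    using cf_sum_insert_le[OF less_imp_le[OF s] F A M] by blast
  obtain k where k: "K = ennreal k" "0 \<le> k" using K(1) by (cases K) auto
  obtain x where x: "cf_sum A s n 1 0 = ennreal x" "0 \<le> x" "x < 1"
    using n by (cases "cf_sum A s n 1 0") (auto simp: ennreal_less_one_iff)
  have "(\<lambda>c. x + k * real c powr (- 2 * s)) \<longlonglongrightarrow> x + k * 0"
    using s by (intro tendsto_intros tendsto_neg_powr filterlim_real_sequentially) auto
  then have "eventually (\<lambda>c. x + k * real c powr (- 2 * s) < 1) sequentially"
    using x by (intro order_tendstoD(2)) auto
  then obtain N where N: "\<And>c. N \<le> c \<Longrightarrow> x + k * real c powr (- 2 * s) < 1"
    by (auto simp: eventually_sequentially)
  have "cf_sum (insert c A) s n 1 0 < 1" if "c \<in> F" "N \<le> c" for c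
  proof -
    have "cf_sum (insert c A) s n 1 0 \<le> ennreal x + ennreal k * ennreal ((real c * 1) powr (- 2 * s))"
      using K(2) that(1) unfolding x(1)[symmetric] k(1)[symmetric] by (meson order_refl zero_less_one)
    also have "\<dots> = ennreal (x + k * real c powr (- 2 * s))"
      using x k by (simp add: ennreal_mult)
    also have "\<dots> < 1" using N[OF that(2)] by (simp only: ennreal_less_one_iff)
    finally show ?thesis .
  qed
  then show ?thesis by blast
qed

subsection \<open>The dimension spectrum\<close>

lemma hausdorff_dim_mono:
  assumes "X \<subseteq> Y"
  shows "hausdorff_dim X \<le> hausdorff_dim Y"
proof -
  have "hausdorff_premeasure s \<delta> X \<le> hausdorff_premeasure s \<delta> Y" for s \<delta>
    unfolding hausdorff_premeasure_def using assms by (intro INF_superset_mono) auto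
  then have "hausdorff_measure s X \<le> hausdorff_measure s Y" for s
    unfolding hausdorff_measure_def by (intro SUP_mono) blast
  then have "hausdorff_measure s Y = 0 \<Longrightarrow> hausdorff_measure s X = 0" for s
    by (metis le_zero_eq)
  then show ?thesis
    unfolding hausdorff_dim_def by (intro Inf_superset_mono) auto
qed

lemma cf_set_mono: "A \<subseteq> B \<Longrightarrow> cf_set A \<subseteq> cf_set B"
  by (auto simp: cf_set_def)

lemma cf_sum_ge_one:
  assumes "A \<subseteq> {2..}" "0 < s" "ennreal s < hausdorff_dim (cf_set A)"
  shows "1 \<le> cf_sum A s n 1 0"
  using hausdorff_dim_cf_set_le[of A s n] assms by (meson leD not_le_imp_less)

section \<open>Greedy choice of digits\<close>

primrec greedy :: "('a set \<Rightarrow> bool) \<Rightarrow> (nat \<Rightarrow> 'a) \<Rightarrow> nat \<Rightarrow> 'a set" where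
  "greedy P e 0 = {}"
| "greedy P e (Suc n) =
    (if P (insert (e n) (greedy P e n)) then insert (e n) (greedy P e n) else greedy P e n)"

text \<open>\<open>P\<close> passes only to finite subsets of the union of the stages; for the
  dimension, the passage to \<open>A\<close> itself is made later by finite approximation.\<close>

lemma greedy_set:
  fixes P :: "'a set \<Rightarrow> bool" and e :: "nat \<Rightarrow> 'a"
  assumes e: "inj e" and P: "P {}" and P_mono: "\<And>B C. B \<subseteq> C \<Longrightarrow> P C \<Longrightarrow> P B"
  obtains A where "A \<subseteq> range e" "\<And>D. finite D \<Longrightarrow> D \<subseteq> A \<Longrightarrow> P D"
    "\<And>n. e n \<notin> A \<Longrightarrow> \<not> P (insert (e n) (A \<inter> e ` {..<n}))"
proof -
  let ?S = "greedy P e"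
  define A where "A = (\<Union>n. ?S n)"
  have mono: "?S m \<subseteq> ?S n" if "m \<le> n" for m n
    by (rule lift_Suc_mono_le[of ?S]) (use that in auto)
  have PS: "P (?S n)" for n using P by (induction n) auto
  have sub: "?S n \<subseteq> e ` {..<n}" for n
    by (induction n) (auto simp: less_Suc_eq)
  have stay: "e k \<in> ?S (Suc k)" if "e k \<in> ?S m" for k m
    using that by (induction m) (auto simp: inj_eq[OF e] split: if_splits)
  have S_eq: "?S n = A \<inter> e ` {..<n}" for n
  proof (intro equalityI subsetI)
    fix x assume "x \<in> A \<inter> e ` {..<n}"
    then obtain k m where k: "x = e k" "k < n" "e k \<in> ?S m" unfolding A_def by auto
    then show "x \<in> ?S n" using stay[OF k(3)] mono[of "Suc k" n] by auto
  qed (use sub[of n] in \<open>auto simp: A_def\<close>)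
  show thesis
  proof (rule that[of A])
    show "A \<subseteq> range e" unfolding A_def using sub by blast
    show "P D" if D: "finite D" "D \<subseteq> A" for D
    proof -
      have "\<exists>n. D \<subseteq> ?S n"
        using D
      proof (induction D rule: finite_induct)
        case (insert x D)
        then obtain n m where "D \<subseteq> ?S n" "x \<in> ?S m" unfolding A_def by auto
        then show ?case
          using mono[of n "max n m"] mono[of m "max n m"] by (intro exI[of _ "max n m"]) auto
      qed simp
      then show ?thesis using P_mono PS by blast
    qed
    show "\<not> P (insert (e n) (A \<inter> e ` {..<n}))" if "e n \<notin> A" for n
    proof
      assume "P (insert (e n) (A \<inter> e ` {..<n}))"
      then have "e n \<in> ?S (Suc n)" unfolding S_eq[symmetric] by simp
      then show False using that unfolding A_def by blast
    qed
  qed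
qed

section \<open>Growth of the digits\<close>

text \<open>The square bound follows from \<open>e (n + 2) \<ge> 2 * e n\<close>. In the last claim
  both sides satisfy the recurrence in \<open>j\<close>, so \<open>j = 0\<close> and
  \<open>j = 1\<close> decide; they rest on \<open>e (Suc m) \<le> 2 * e m\<close>, which comes from
  the recurrence and hence from \<open>1 \<le> m\<close>.\<close>

lemma fibonacci_like_growth:
  fixes e :: "nat \<Rightarrow> nat"
  assumes "2 \<le> e 0" "e 0 < e 1" "\<And>n. e (Suc (Suc n)) = e (Suc n) + e n"
  shows "strict_mono e" "2 ^ n \<le> (e n)\<^sup>2"
    and fibonacci_like_submult: "1 \<le> m \<Longrightarrow> e (m + Suc j) \<le> e m * e j"
proof -
  have two: "2 \<le> e n" for n
    by (induction n rule: less_induct) (metis One_nat_def assms less_imp_le less_trans le_less_trans not0_implies_Suc trans_le_add2 lessI)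
  have inc: "e n < e (Suc n)" for n
  proof (cases n)
    case (Suc k)
    then show ?thesis using assms(3)[of k] two[of k] by simp
  qed (use assms in simp)
  then show "strict_mono e" by (simp add: strict_mono_Suc_iff)
  show "2 ^ n \<le> (e n)\<^sup>2"
  proof (induction n rule: nat_less_induct)
    case (1 n)
    consider "n = 0" | "n = 1" | k where "n = Suc (Suc k)" by (metis One_nat_def not0_implies_Suc)
    then show ?case
    proof cases
      case 1
      then show ?thesis using assms(1) by (simp add: power2_eq_square)
    next
      case 2
      then show ?thesis using two[of 1] power_mono[of 2 "e 1" 2] by simp
    next
      case (3 k)
      then have "2 * e k \<le> e n" using assms(3)[of k] inc[of k] by simp
      then have "(2 * e k)\<^sup>2 \<le> (e n)\<^sup>2" by (rule power_mono) simp
      moreover have "2 ^ k \<le> (e k)\<^sup>2" using "1" 3 by simp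
      ultimately show ?thesis using 3 by (simp add: power_mult_distrib)
    qed
  qed
  assume "1 \<le> m"
  then obtain k where k: "m = Suc k" by (cases m) auto
  have le: "e (Suc m) \<le> 2 * e m" using assms(3)[of k] inc[of k] k by simp
  show "e (m + Suc j) \<le> e m * e j"
  proof (induction j rule: nat_less_induct)
    case (1 j)
    consider "j = 0" | "j = 1" | i where "j = Suc (Suc i)" by (metis One_nat_def not0_implies_Suc)
    then show ?case
    proof cases
      case 1
      then have "e (m + Suc j) = e (Suc m)" by simp
      also have "\<dots> \<le> e m * 2" using le by simp
      also have "\<dots> \<le> e m * e j" using \<open>j = 0\<close> assms(1) by simp
      finally show ?thesis .
    next
      case 2
      have "3 \<le> e 1" using assms by simp
      then have "e m * 3 \<le> e m * e j" using 2 by simp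
      moreover have "e (m + Suc j) = e (Suc m) + e m" using 2 assms(3)[of m] by simp
      ultimately show ?thesis using le by linarith
    next
      case (3 i)
      then show ?thesis using "1"[rule_format, of "Suc i"] "1"[rule_format, of i]
          assms(3)[of "m + Suc i"] assms(3)[of i] by (simp add: algebra_simps)
    qed
  qed
qed

lemma nn_integral_count_space_image:
  "inj_on g A \<Longrightarrow> (\<integral>\<^sup>+x. f x \<partial>count_space (g ` A)) = (\<integral>\<^sup>+x. f (g x) \<partial>count_space A)"
  by (rule nn_integral_bij_count_space[symmetric]) (rule inj_on_imp_bij_betw)

lemma ennreal_real_between:
  fixes x y :: ennreal
  assumes "0 < x" "x < y"
  obtains s where "x = ennreal s" "0 < s"
  using assms by (cases x) auto

section \<open>Realising an intermediate dimension\<close>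

lemma dim_spectrum_fibonacci_like:
  fixes e :: "nat \<Rightarrow> nat"
  assumes e: "2 \<le> e 0" "e 0 < e 1" "\<And>n. e (Suc (Suc n)) = e (Suc n) + e n"
    and t: "0 < t" "t < hausdorff_dim (cf_set (range e))"
  shows "\<exists>A\<subseteq>range e. hausdorff_dim (cf_set A) = t"
proof -
  let ?dim = "\<lambda>B. hausdorff_dim (cf_set B)"
  have mono: "strict_mono e" by (rule fibonacci_like_growth[of e, OF e])
  then have inj: "inj e" by (rule strict_mono_imp_inj_on)
  have F: "range e \<subseteq> {2..}"
    using e(1) strict_mono_less_eq[OF mono] by (auto intro: order_trans)
  then have F1: "range e \<subseteq> {1..}" by auto
  have dim_mono: "?dim B \<le> ?dim C" if "B \<subseteq> C" for B C
    using that by (intro hausdorff_dim_mono cf_set_mono)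
  obtain A where A: "A \<subseteq> range e" and A_fin: "\<And>D. finite D \<Longrightarrow> D \<subseteq> A \<Longrightarrow> ?dim D \<le> t"
    and A_out: "\<And>n. e n \<notin> A \<Longrightarrow> \<not> ?dim (insert (e n) (A \<inter> e ` {..<n})) \<le> t"
  proof (rule greedy_set[OF inj, where P = "\<lambda>B. ?dim B \<le> t"])
    have "cf_set {} = {}" by (simp add: cf_set_def)
    then show "?dim {} \<le> t" by (simp add: hausdorff_dim_empty)
    show "?dim B \<le> t" if "B \<subseteq> C" "?dim C \<le> t" for B C
      using dim_mono[OF that(1)] that(2) by (rule order_trans)
  qed (rule that)
  have A2: "A \<subseteq> {2..}" using A F by blast
  have weights: "cf_sum (range e) s 1 1 0 = (\<Sum>k. ennreal (real (e k) powr (- 2 * s)))" for s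
    by (simp add: nn_integral_count_space_image[OF inj] nn_integral_count_space_nat)
  have approx: "\<exists>D. finite D \<and> D \<subseteq> A \<and> x \<le> ?dim D"
    if xy: "0 < x" "x < ennreal s" and n: "\<And>n. 1 \<le> cf_sum A s n 1 0" for x s
  proof -
    obtain y where y: "x = ennreal y" "0 \<le> y" using xy by (cases x) auto
    then have "0 < y" "y < s" using xy by (auto simp: ennreal_less_iff)
    then show ?thesis
      using hausdorff_dim_cf_set_finite_subset[OF A2 _ _ n, of y] y by metis
  qed
  \<comment> \<open>A dimension above \<open>t\<close> would be visible on a finite subset of
    \<open>A\<close>, against the greedy choice.\<close>
  have "?dim A \<le> t"
  proof (rule ccontr)
    assume "\<not> ?dim A \<le> t"
    then obtain x where x: "t < x" "x < ?dim A" using dense by (metis not_le)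
    obtain s where s: "x = ennreal s" "0 < s"
      using less_trans[OF t(1) x(1)] x(2) by (rule ennreal_real_between)
    obtain y where y: "t < y" "y < x" using x dense by blast
    have "1 \<le> cf_sum A s n 1 0" for n
      using x s by (intro cf_sum_ge_one A2) auto
    then obtain D where "finite D" "D \<subseteq> A" "y \<le> ?dim D"
      using approx[of y s] y s t by (metis less_trans)
    then show False using A_fin[of D] y by (meson leD order_trans)
  qed
  moreover have "t \<le> ?dim A"
  proof (rule ccontr)
    assume "\<not> t \<le> ?dim A"
    then obtain x where x: "?dim A < x" "x < t" using dense by (metis not_le)
    obtain s where s: "x = ennreal s" "0 < s"
      using le_less_trans[OF zero_le x(1)] x(2) by (rule ennreal_real_between)
    obtain y where y: "?dim A < y" "y < x" using x dense by blast
    \<comment> \<open>Here \<open>s\<close> lies strictly between the dimension of \<open>A\<close>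
      and \<open>t\<close>; if all partition functions were at least 1, a finite subset of
      \<open>A\<close> would have dimension at least \<open>y\<close>.\<close>
    have "\<exists>n. cf_sum A s n 1 0 < 1"
    proof (rule ccontr)
      assume "\<nexists>n. cf_sum A s n 1 0 < 1"
      then have "1 \<le> cf_sum A s n 1 0" for n by (simp add: not_less)
      then obtain D where "D \<subseteq> A" "y \<le> ?dim D"
        using approx[of y s] y s by (metis le_less_trans zero_le)
      then show False using dim_mono[of D A] y by (meson leD order_trans)
    qed
    then obtain n where n: "cf_sum A s n 1 0 < 1" ..
    \<comment> \<open>A rejected digit pushes the dimension above \<open>t\<close>, and
      \<open>t\<close> exceeds \<open>s\<close>.\<close>
    have out: "1 \<le> cf_sum (insert (e m) (A \<inter> e ` {..<m})) s k 1 0" if "e m \<notin> A" for m k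
      using A_out[OF that] x s F A by (intro cf_sum_ge_one) (auto simp: not_le intro: less_trans)
    define X where "X = {m. e m \<notin> A}"
    have "X \<noteq> {}"
    proof
      assume "X = {}"
      then have "A = range e" using A unfolding X_def by auto
      then show False using x t by (metis less_trans less_asym)
    qed
    text \<open>If infinitely many digits are left out, adding a large one to \<open>A\<close> hardly changes the
      partition function; otherwise the last one left out is outweighed by all later digits.\<close>
    show False
    proof (cases "finite X")
      case False
      \<comment> \<open>A geometric bound on the weights provides the finiteness needed to add a
        large digit.\<close>
      have "real (e k) powr (- 2 * s) \<le> (2 powr (- s)) ^ k" for k
      proof -
        have "real (2 ^ k) \<le> real ((e k)\<^sup>2)" by (rule of_nat_mono) (rule fibonacci_like_growth[of e, OF e])
        then have "(real (e k))\<^sup>2 powr (- s) \<le> (2 ^ k) powr (- s)"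
          using s by (intro powr_mono2') auto
        moreover have "(real (e k))\<^sup>2 powr (- s) = real (e k) powr (- 2 * s)"
          by (simp add: powr_powr flip: powr_numeral)
        moreover have "(2 ^ k) powr (- s) = (2 powr (- s)) ^ k"
          by (simp add: powr_realpow[symmetric] powr_powr mult.commute)
        ultimately show ?thesis by simp
      qed
      then have "cf_sum (range e) s 1 1 0 \<le> (\<Sum>k. ennreal ((2 powr (- s)) ^ k))"
        unfolding weights by (intro suminf_le ennreal_leI) auto
      also have "\<dots> = ennreal (1 / (1 - 2 powr (- s)))"
        using s by (intro suminf_ennreal_eq geometric_sums) (auto simp: powr_minus inverse_less_1_iff)
      also have "\<dots> < \<infinity>" by simp
      finally obtain N where N: "\<forall>c\<in>range e. N \<le> c \<longrightarrow> cf_sum (insert c A) s n 1 0 < 1"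
        using cf_sum_insert_less_one[OF s(2) F1 A _ n] by blast
      obtain m where m: "N \<le> m" "m \<in> X"
        using False by (meson infinite_nat_iff_unbounded_le)
      have "m \<le> e m" using mono by (rule strict_mono_imp_increasing)
      then have "cf_sum (insert (e m) A) s n 1 0 < 1" using N m by auto
      moreover have "1 \<le> cf_sum (insert (e m) A) s n 1 0"
        using out[of m n] m cf_sum_mono[of "insert (e m) (A \<inter> e ` {..<m})" "insert (e m) A" s n 1 0]
        unfolding X_def by (auto intro: order_trans)
      ultimately show False by simp
    next
      case True
      define m where "m = Max X"
      have m: "m \<in> X" unfolding m_def using True \<open>X \<noteq> {}\<close> by (rule Max_in)
      have later: "e k \<in> A" if "m < k" for k
        using Max_ge[OF True, of k] that unfolding m_def by (auto simp: X_def)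
      define B where "B = A \<inter> e ` {..<m}"
      define T where "T = e ` {m<..}"
      \<comment> \<open>Were \<open>e 0\<close> the last rejected digit, \<open>out\<close> would
        apply to the alphabet \<open>{e 0}\<close>, whose partition function at length 1 is below
        1.\<close>
      have "1 \<le> m"
      proof (rule ccontr)
        assume "\<not> 1 \<le> m"
        then have "m = 0" by simp
        then have "1 \<le> cf_sum {e 0} s 1 1 0" using out[of m 1] m unfolding X_def by simp
        also have "\<dots> = ennreal (real (e 0) powr (- 2 * s))"
          by (simp add: nn_integral_count_space_finite)
        also have "\<dots> < 1"
          using e(1) s by (simp add: ennreal_less_one_iff powr_less_one)
        finally show False by simp
      qed
      \<comment> \<open>The total weight of all digits is at least 1. Multiplying it by the weight
        of \<open>e m\<close> and using submultiplicativity of the digits bounds this weight by that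
        of the later digits.\<close>
      have "1 \<le> cf_sum (range e) s 1 1 0"
        using x s t F by (intro cf_sum_ge_one) (auto intro: less_trans)
      then have "ennreal (real (e m) powr (- 2 * s))
          \<le> ennreal (real (e m) powr (- 2 * s)) * (\<Sum>j. ennreal (real (e j) powr (- 2 * s)))"
        unfolding weights using mult_left_mono[of 1 _ "ennreal (real (e m) powr (- 2 * s))"] by simp
      also have "\<dots> = (\<Sum>j. ennreal ((real (e m) * real (e j)) powr (- 2 * s)))"
        by (subst ennreal_suminf_cmult[symmetric]) (simp add: ennreal_mult powr_mult)
      also have "\<dots> \<le> (\<Sum>j. ennreal (real (e (m + Suc j)) powr (- 2 * s)))"
      proof (intro suminf_le ennreal_leI powr_minus_antimono)
        fix j
        show "0 < real (e (m + Suc j))" using F by (metis atLeast_iff of_nat_0_less_iff pos2 less_le_trans rangeI subsetD)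
        show "real (e (m + Suc j)) \<le> real (e m) * real (e j)"
          using fibonacci_like_submult[of e, OF e \<open>1 \<le> m\<close>, of j] by (metis of_nat_mono of_nat_mult)
      qed (use s in auto)
      also have "\<dots> = (\<integral>\<^sup>+j. ennreal (real (e (m + Suc j)) powr (- 2 * s)) \<partial>count_space UNIV)"
        by (simp add: nn_integral_count_space_nat)
      also have "\<dots> = (\<integral>\<^sup>+k. ennreal (real k powr (- 2 * s)) \<partial>count_space (range (\<lambda>j. e (m + Suc j))))"
        by (intro nn_integral_count_space_image[symmetric]) (simp add: inj_on_def inj_eq[OF inj])
      also have "range (\<lambda>j. e (m + Suc j)) = T"
        unfolding T_def by (auto simp: image_iff) (metis add_Suc_right less_natE)
      finally have weight: "ennreal (real (e m) powr (- 2 * s))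
          \<le> (\<integral>\<^sup>+k. ennreal (real k powr (- 2 * s)) \<partial>count_space T)" .
      \<comment> \<open>Exchanging \<open>e m\<close> for all later digits leads into
        \<open>A\<close>, contradicting the choice of \<open>n\<close>.\<close>
      have "1 \<le> cf_sum (insert (e m) B) s n 1 0"
        using out[of m n] m unfolding X_def B_def by simp
      also have "\<dots> \<le> cf_sum (B \<union> T) s n 1 0"
      proof (rule cf_sum_replace_digit[OF _ _ _ _ _ weight])
        show "B \<subseteq> {1..}" using A F1 unfolding B_def by blast
        show "1 \<le> e m" using F1 by auto
        show "T \<subseteq> {e m..}" unfolding T_def using strict_mono_less_eq[OF mono] by auto
        show "B \<inter> T = {}" unfolding B_def T_def using inj by (auto simp: inj_eq)
      qed (use s in auto)
      also have "\<dots> \<le> cf_sum A s n 1 0"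
        using later unfolding B_def T_def by (intro cf_sum_mono) auto
      finally show False using n by simp
    qed
  qed
  ultimately show ?thesis using A by (metis antisym)
qed

theorem theorem1p1:
  fixes a :: "nat \<Rightarrow> nat" and F :: "nat set"
  assumes "2 \<le> a 1" and "a 1 < a 2"
    and "\<And>n. 3 \<le> n \<Longrightarrow> a n = a (n - 1) + a (n - 2)"
    and "F = {a n | n. 1 \<le> n}"
  shows "{0..hausdorff_dim (cf_set F)} = dim_spectrum F"
proof (intro equalityI subsetI)
  fix t assume "t \<in> dim_spectrum F"
  then obtain A where A: "A \<subseteq> F" "t = hausdorff_dim (cf_set A)"
    unfolding dim_spectrum_def by blast
  show "t \<in> {0..hausdorff_dim (cf_set F)}"
    using hausdorff_dim_mono[OF cf_set_mono[OF A(1)]] A(2) by simp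
next
  fix t assume "t \<in> {0..hausdorff_dim (cf_set F)}"
  then consider "t = 0" | "t = hausdorff_dim (cf_set F)" | "0 < t" "t < hausdorff_dim (cf_set F)"
    by (force simp: less_le)
  then show "t \<in> dim_spectrum F"
  proof cases
    case 1
    moreover have "cf_set {} = {}" by (simp add: cf_set_def)
    ultimately show ?thesis
      unfolding dim_spectrum_def by (auto intro!: exI[of _ "{}"] simp: hausdorff_dim_empty)
  next
    case 2
    then show ?thesis unfolding dim_spectrum_def by auto
  next
    case 3
    \<comment> \<open>The index is shifted so that the digits start at 0.\<close>
    have F: "F = range (\<lambda>n. a (Suc n))"
      unfolding assms(4) by (auto simp: image_iff) (metis Suc_le_D)
    have "\<exists>A\<subseteq>range (\<lambda>n. a (Suc n)). hausdorff_dim (cf_set A) = t"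
      by (rule dim_spectrum_fibonacci_like)
        (use assms(1,2) assms(3)[of "Suc (Suc (Suc _))"] 3 in \<open>auto simp: F numeral_2_eq_2\<close>)
    then show ?thesis unfolding dim_spectrum_def F by auto
  qed
qed

end
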